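(* Let $K$ be an oriented knot in an integral homology 3-sphere $\Sigma$ with exterior $N_K$, let $n\ge1$, let $H=H_1(N_K;\mathbb{Z}[t^{\pm1}])$, and let $\chi\colon H\to\mathbb{C}^*$ be a character that factors through $H/(t^n-1)$. Let $\alpha=\alpha_{(n,\chi)}\colon\pi_1(N_K)\to\mathrm{SL}(n,\mathbb{C})$ be the associated metabelian representation. Then, up to multiplication by units of $\mathbb{C}[t^{\pm1}]$, $$\Delta^\alpha_{K,0}(t)=\begin{cases}1-t^n,&\text{if }\chi\text{ is trivial},\\ 1,&\text{otherwise.}\end{cases}$$ Furthermore, the twisted Alexander polynomial $\Delta^\alpha_{K,1}(t)$ is actually a polynomial in $t^n$ (up to multiplication by a unit of $\mathbb{C}[t^{\pm1}]$).
   Context: A knot $K$ is an oriented simple closed curve in an integral homology 3-sphere $\Sigma$; $N_K=\Sigma\smallsetminus\tau(K)$, where $\tau(K)$ is an open tubular neighborhood of $K$. Write $\pi=\pi_1(N_K)$ and let $\varepsilon\colon\pi\to H_1(N_K)=\mathbb{Z}$ be the abelianization, with the identification $H_1(N_K)=\mathbb{Z}$ determined by the orientation of $K$. Let $\mu$ be a meridian of $K$, so $\varepsilon(\mu)=1$. Put $\pi^{(1)}=[\pi,\pi]$ and $\pi^{(2)}=[\pi^{(1)},\pi^{(1)}]$. Then $H=H_1(N_K;\mathbb{Z}[t^{\pm1}])$ is the first homology of the infinite cyclic cover of $N_K$, identified with $\pi^{(1)}/\pi^{(2)}$, with $\mathbb{Z}[t^{\pm1}]$-module structure $t^k\cdot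 g=\mu^{-k}g\mu^k$. There is an isomorphism $\pi/\pi^{(2)}\cong\mathbb{Z}\ltimes H$, $g\mapsto(\varepsilon(g),\mu^{-\varepsilon(g)}g)$, where the product is $(i,h)(j,k)=(i+j,\,t^jh+k)$ (with $H$ written additively). Representations of $\mathbb{Z}\ltimes H$ are regarded as representations of $\pi$ via $\pi\to\pi/\pi^{(2)}\cong\mathbb{Z}\ltimes H$. Let $\chi\colon H\to\mathbb{C}^*$ be a character (group homomorphism) that factors through $H/(t^n-1)$, and let $z\in S^1\subset\mathbb{C}$ with $z^n=(-1)^{n+1}$. Let $P_z$ be the $n\times n$ matrix with $P_ze_i=z\,e_{i+1}$ for $1\le i<n$ and $P_ze_n=z\,e_1$. Then $\alpha_{(n,\chi)}\colon\mathbb{Z}\ltimes H\to\mathrm{SL}(n,\mathbb{C})$ is the representation $$\alpha_{(n,\chi)}(j,h)=P_z^{\,j}\,\operatorname{diag}\big(\chi(h),\chi(th),\dots,\chi(t^{n-1}h)\big).$$ Its isomorphism type does not depend on the choice of $z$. Twisted Alexander polynomials: for a representation $\alpha\colon\pi\to\mathrm{GL}(n,\mathbb{C})$, let $\pi$ act on $\mathbb{C}^n\otimes_{\mathbb{C}}\mathbb{C}[t^{\pm1}]$ by $g\mapsto\alpha(g)\otimes t^{\varepsilon(g)}$, and consider the twisted homology $H_i(N_K;\mathbb{C}^n\otimes\mathbb{C}[t^{\pm1}])$ with these local coefficients, a finitely generated module over the PID $\mathbb{C}[t^{\pm1}]$. The $i$-th twisted Alexander polynomial $\Delta^\alpha_{K,i}(t)\in\mathbb{C}[t^{\pm1}]$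 is the order of this module: if the module is isomorphic to $\bigoplus_j\mathbb{C}[t^{\pm1}]/(p_j)$, the order is $\prod_jp_j$ (so it is $0$ if the module is not torsion and $1$ if the module is zero). It is well defined up to multiplication by units $ct^k$ ($c\in\mathbb{C}^*$, $k\in\mathbb{Z}$) of $\mathbb{C}[t^{\pm1}]$.
   Formalization: For trivial χ the formal theorem gives Δ_{K,0} = 1 − (−1)^{n+1}t^n instead of 1 − t^n; the printed formula fails for even n (unknot, n = 2, z = i gives 1 + t^2). *)

theory Defs
  imports
    "HOL-Homology.Homology"
    "HOL-Algebra.Algebra"
    "HOL-Library.Poly_Mapping"
    "HOL-Computational_Algebra.Polynomial"
    "Jordan_Normal_Form.Matrix"
begin

section \<open>Knots in integral homology 3-spheres\<close>

text \<open>The ambient type is \<open>t2_space\<close>, so the Hausdorff axiom is built in; compactness and the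
  local Euclidean charts then give second countability. The homology condition in degrees 0
  and 3 yields connectedness and orientability.\<close>

definition integral_homology_3_sphere :: "'a::t2_space set \<Rightarrow> bool" where
  "integral_homology_3_sphere S \<longleftrightarrow>
     compact S \<and>
     (\<forall>x\<in>S. \<exists>U. openin (top_of_set S) U \<and> x \<in> U \<and> U homeomorphic (UNIV :: (real^3) set)) \<and>
     (\<forall>p. homology_group p (top_of_set S) \<cong> homology_group p (nsphere 3))"

definition oriented_simple_closed_curve :: "'a::t2_space set \<Rightarrow> (real \<Rightarrow> 'a) \<Rightarrow> bool" where
  "oriented_simple_closed_curve S K \<longleftrightarrow>
     simple_path K \<and> pathfinish K = pathstart K \<and> path_image K \<subseteq> S"

text \<open>A parametrisation \<open>\<phi>\<close> of a neighbourhood of the knot by \<open>S\<^sup>1 \<times> \<complex>\<close>, with the knot as core;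
  its existence is the tameness of the knot. The open tubular neighbourhood \<open>\<tau>(K)\<close> is the image
  of \<open>S\<^sup>1 \<times>\<close> (open unit disc), so \<open>\<phi>\<close> also provides a collar of the boundary torus of the
  exterior. The orientations of \<open>S\<^sup>1 \<times> \<complex>\<close> and of the core determine the orientation of the
  ambient homology sphere for which \<open>\<phi>\<close> is orientation preserving; every oriented knot in an
  oriented homology sphere arises from a suitable \<open>\<phi>\<close>.\<close>

definition tubular_parametrization ::
    "'a::t2_space set \<Rightarrow> (real \<Rightarrow> 'a) \<Rightarrow> (complex \<times> complex \<Rightarrow> 'a) \<Rightarrow> bool" where
  "tubular_parametrization S K \<phi> \<longleftrightarrow>
     (\<forall>s\<in>{0..1}. \<phi> (cis (2 * pi * s), 0) = K s) \<and>
     openin (top_of_set S) (\<phi> ` (sphere 0 1 \<times> UNIV)) \<and>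
     (\<exists>\<psi>. homeomorphism (sphere 0 1 \<times> UNIV) (\<phi> ` (sphere 0 1 \<times> UNIV)) \<phi> \<psi>)"

definition knot_exterior :: "'a::t2_space set \<Rightarrow> (complex \<times> complex \<Rightarrow> 'a) \<Rightarrow> 'a set" where
  "knot_exterior S \<phi> = S - \<phi> ` (sphere 0 1 \<times> ball 0 1)"


section \<open>The fundamental group and meridians\<close>

definition path_class :: "'a::topological_space set \<Rightarrow> (real \<Rightarrow> 'a) \<Rightarrow> (real \<Rightarrow> 'a) set" where
  "path_class N p = {q. homotopic_paths N p q}"

text \<open>The product of two classes is represented by running through the first loop, then the
  second.\<close>

definition fundamental_group :: "'a::topological_space set \<Rightarrow> 'a \<Rightarrow> (real \<Rightarrow> 'a) set monoid" where
  "fundamental_group N x0 =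
     \<lparr>carrier = {path_class N p | p. path p \<and> path_image p \<subseteq> N \<and> pathstart p = x0 \<and> pathfinish p = x0},
      monoid.mult = (\<lambda>A B. \<Union>p\<in>A. \<Union>q\<in>B. path_class N (p +++ q)),
      one = path_class N (\<lambda>_. x0)\<rparr>"

definition is_meridian ::
    "'a::t2_space set \<Rightarrow> (complex \<times> complex \<Rightarrow> 'a) \<Rightarrow> 'a \<Rightarrow> (real \<Rightarrow> 'a) set \<Rightarrow> bool" where
  "is_meridian N \<phi> x0 m \<longleftrightarrow>
     (\<exists>u\<in>sphere 0 1. \<exists>\<beta>. path \<beta> \<and> path_image \<beta> \<subseteq> N \<and> pathstart \<beta> = x0 \<and> pathfinish \<beta> = \<phi> (u, 1) \<and>
        m = path_class N (\<beta> +++ ((\<lambda>s. \<phi> (u, cis (2 * pi * s))) +++ reversepath \<beta>)))"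

text \<open>The homomorphism \<open>\<epsilon>\<close> is the abelianization onto \<open>\<int>\<close>, normalised by a meridian.\<close>

definition is_abelianization_to_int :: "('g, 'b) monoid_scheme \<Rightarrow> 'g \<Rightarrow> ('g \<Rightarrow> int) \<Rightarrow> bool" where
  "is_abelianization_to_int G m \<epsilon> \<longleftrightarrow>
     \<epsilon> \<in> epi G integer_group \<and> kernel G integer_group \<epsilon> = derived G (carrier G) \<and> \<epsilon> m = 1"


section \<open>The Alexander module and its characters\<close>

abbreviation commutator_subgroup :: "('g, 'b) monoid_scheme \<Rightarrow> 'g set" where
  "commutator_subgroup G \<equiv> derived G (carrier G)"

abbreviation second_commutator_subgroup :: "('g, 'b) monoid_scheme \<Rightarrow> 'g set" where
  "second_commutator_subgroup G \<equiv> derived G (derived G (carrier G))"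

text \<open>\<open>H = \<pi>\<^sup>(\<^sup>1\<^sup>) / \<pi>\<^sup>(\<^sup>2\<^sup>)\<close>, written multiplicatively.\<close>

definition alexander_group :: "('g, 'b) monoid_scheme \<Rightarrow> 'g set monoid" where
  "alexander_group G = (G\<lparr>carrier := commutator_subgroup G\<rparr>) Mod second_commutator_subgroup G"

text \<open>\<open>t\<^sup>k\<close> acts on \<open>H\<close> by \<open>g \<mapsto> \<mu>\<^sup>-\<^sup>k g \<mu>\<^sup>k\<close>, applied here elementwise to cosets of \<open>\<pi>\<^sup>(\<^sup>2\<^sup>)\<close>.\<close>

definition t_action :: "('g, 'b) monoid_scheme \<Rightarrow> 'g \<Rightarrow> int \<Rightarrow> 'g set \<Rightarrow> 'g set" where
  "t_action G m k h = (\<lambda>g. m [^]\<^bsub>G\<^esub> (- k) \<otimes>\<^bsub>G\<^esub> g \<otimes>\<^bsub>G\<^esub> m [^]\<^bsub>G\<^esub> k) ` h"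

text \<open>The submodule \<open>(t\<^sup>n - 1) H\<close>.\<close>

definition t_power_minus_one_image :: "('g, 'b) monoid_scheme \<Rightarrow> 'g \<Rightarrow> nat \<Rightarrow> 'g set set" where
  "t_power_minus_one_image G m n =
     (\<lambda>h. t_action G m (int n) h \<otimes>\<^bsub>alexander_group G\<^esub> inv\<^bsub>alexander_group G\<^esub> h)
       ` carrier (alexander_group G)"

definition complex_units :: "complex monoid" where
  "complex_units = \<lparr>carrier = UNIV - {0}, monoid.mult = (*), one = 1\<rparr>"

definition factors_through_t_power_quotient ::
    "('g, 'b) monoid_scheme \<Rightarrow> 'g \<Rightarrow> nat \<Rightarrow> ('g set \<Rightarrow> complex) \<Rightarrow> bool" where
  "factors_through_t_power_quotient G m n chi \<longleftrightarrow>
     (\<exists>chi' \<in> hom (alexander_group G Mod t_power_minus_one_image G m n) complex_units.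
        \<forall>h\<in>carrier (alexander_group G).
          chi h = chi' (t_power_minus_one_image G m n #>\<^bsub>alexander_group G\<^esub> h))"

definition trivial_character :: "('g, 'b) monoid_scheme \<Rightarrow> ('g set \<Rightarrow> complex) \<Rightarrow> bool" where
  "trivial_character G chi \<longleftrightarrow> (\<forall>h\<in>carrier (alexander_group G). chi h = 1)"


section \<open>Metabelian representations\<close>

text \<open>Indices run over \<open>0, \<dots>, n - 1\<close>. Note \<open>det (1 - t P\<^sub>z) = 1 - z\<^sup>n t\<^sup>n\<close>. As \<open>z\<^sup>n = (-1)\<^sup>n\<^sup>+\<^sup>1\<close>, which is
  what makes \<open>det P\<^sub>z = 1\<close>, this is \<open>1 - t\<^sup>n\<close> for odd \<open>n\<close> but \<open>1 + t\<^sup>n\<close> for even \<open>n\<close>; it is the order of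
  the 0-th twisted homology for the trivial character.\<close>

definition cyclic_matrix :: "nat \<Rightarrow> complex \<Rightarrow> complex mat" where
  "cyclic_matrix n z = Matrix.mat n n (\<lambda>(r, c). if r = Suc c mod n then z else 0)"

abbreviation GL :: "nat \<Rightarrow> complex mat monoid" where
  "GL n \<equiv> units_of (ring_mat TYPE(complex) n ())"

text \<open>The isomorphism \<open>\<pi> / \<pi>\<^sup>(\<^sup>2\<^sup>) \<cong> \<int> \<ltimes> H\<close>, precomposed with the projection from \<open>\<pi>\<close>.\<close>

definition to_semidirect ::
    "('g, 'b) monoid_scheme \<Rightarrow> 'g \<Rightarrow> ('g \<Rightarrow> int) \<Rightarrow> 'g \<Rightarrow> int \<times> 'g set" where
  "to_semidirect G m \<epsilon> g =
     (\<epsilon> g, second_commutator_subgroup G #>\<^bsub>G\<^esub> (m [^]\<^bsub>G\<^esub> (- \<epsilon> g) \<otimes>\<^bsub>G\<^esub> g))"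

definition semidirect_rep ::
    "('g, 'b) monoid_scheme \<Rightarrow> 'g \<Rightarrow> nat \<Rightarrow> ('g set \<Rightarrow> complex) \<Rightarrow> complex \<Rightarrow> int \<times> 'g set \<Rightarrow> complex mat" where
  "semidirect_rep G m n chi z = (\<lambda>(j, h).
     cyclic_matrix n z [^]\<^bsub>GL n\<^esub> j * mat_diag n (\<lambda>i. chi (t_action G m (int i) h)))"

definition metabelian_rep ::
    "('g, 'b) monoid_scheme \<Rightarrow> 'g \<Rightarrow> ('g \<Rightarrow> int) \<Rightarrow> nat \<Rightarrow> ('g set \<Rightarrow> complex) \<Rightarrow> complex \<Rightarrow> 'g \<Rightarrow> complex mat" where
  "metabelian_rep G m \<epsilon> n chi z g = semidirect_rep G m n chi z (to_semidirect G m \<epsilon> g)"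


section \<open>Laurent polynomials and orders of modules\<close>

text \<open>\<open>\<complex>[t\<^sup>\<plusminus>\<^sup>1]\<close> is the group algebra of \<open>\<int>\<close>; \<open>Poly_Mapping.single k c\<close> is \<open>c t\<^sup>k\<close>.\<close>

type_synonym laurent = "int \<Rightarrow>\<^sub>0 complex"

definition laurent_ring :: "laurent ring" where
  "laurent_ring = \<lparr>carrier = UNIV, monoid.mult = (*), one = 1, zero = 0, add = (+)\<rparr>"

definition equal_up_to_unit :: "laurent \<Rightarrow> laurent \<Rightarrow> bool" where
  "equal_up_to_unit p q \<longleftrightarrow> (\<exists>c k. c \<noteq> 0 \<and> p = Poly_Mapping.single k c * q)"

text \<open>The value at \<open>t\<^sup>n\<close> of the polynomial \<open>q\<close>.\<close>

definition poly_in_t_power :: "nat \<Rightarrow> complex poly \<Rightarrow> laurent" where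
  "poly_in_t_power n q = (\<Sum>i\<le>Polynomial.degree q. Poly_Mapping.single (int (n * i)) (Polynomial.coeff q i))"

text \<open>Module records inherit the fields \<open>mult\<close> and \<open>one\<close> from rings; they play no role in the
  module axioms and are filled arbitrarily below.\<close>

definition quotient_module :: "('r, 'm) module \<Rightarrow> 'm set \<Rightarrow> ('r, 'm set) module" where
  "quotient_module M N =
     \<lparr>carrier = a_rcosets\<^bsub>M\<^esub> N, monoid.mult = (\<lambda>_ _. N), one = N,
      zero = N, add = set_add M,
      module.smult = (\<lambda>a C. \<Union>c\<in>C. N +>\<^bsub>M\<^esub> (a \<odot>\<^bsub>M\<^esub> c))\<rparr>"

text \<open>\<open>\<Oplus>\<^sub>j \<complex>[t\<^sup>\<plusminus>\<^sup>1] / (p\<^sub>j)\<close>\<close>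

definition cyclic_sum_module :: "laurent list \<Rightarrow> (laurent, nat \<Rightarrow> laurent set) module" where
  "cyclic_sum_module ps =
     (let I = (\<lambda>j. PIdl\<^bsub>laurent_ring\<^esub> (ps ! j)); Q = (\<lambda>j. laurent_ring Quot I j); J = {..<length ps} in
      \<lparr>carrier = (\<Pi>\<^sub>E j\<in>J. carrier (Q j)),
       monoid.mult = (\<lambda>f g. \<lambda>j\<in>J. f j \<otimes>\<^bsub>Q j\<^esub> g j),
       one = (\<lambda>j\<in>J. \<one>\<^bsub>Q j\<^esub>),
       zero = (\<lambda>j\<in>J. \<zero>\<^bsub>Q j\<^esub>),
       add = (\<lambda>f g. \<lambda>j\<in>J. f j \<oplus>\<^bsub>Q j\<^esub> g j),
       module.smult = (\<lambda>a f. \<lambda>j\<in>J. (I j +>\<^bsub>laurent_ring\<^esub> a) \<otimes>\<^bsub>Q j\<^esub> f j)\<rparr>)"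

definition module_isomorphic ::
    "('r, 'c) ring_scheme \<Rightarrow> ('r, 'm) module \<Rightarrow> ('r, 'n) module \<Rightarrow> bool" where
  "module_isomorphic R M N \<longleftrightarrow>
     (\<exists>f. bij_betw f (carrier M) (carrier N) \<and>
          (\<forall>x\<in>carrier M. \<forall>y\<in>carrier M. f (x \<oplus>\<^bsub>M\<^esub> y) = f x \<oplus>\<^bsub>N\<^esub> f y) \<and>
          (\<forall>a\<in>carrier R. \<forall>x\<in>carrier M. f (a \<odot>\<^bsub>M\<^esub> x) = a \<odot>\<^bsub>N\<^esub> f x))"

text \<open>Orders are only well defined up to units, whence a relation.\<close>

definition is_order_of :: "laurent \<Rightarrow> (laurent, 'm) module \<Rightarrow> bool" where
  "is_order_of p M \<longleftrightarrow>
     (\<exists>ps. module_isomorphic laurent_ring M (cyclic_sum_module ps) \<and> p = prod_list ps)"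


section \<open>Twisted homology\<close>

text \<open>The action of \<open>g\<close> on \<open>\<complex>\<^sup>n \<otimes> \<complex>[t\<^sup>\<plusminus>\<^sup>1]\<close> by \<open>\<alpha>(g) \<otimes> t\<^sup>\<epsilon>\<^sup>(\<^sup>g\<^sup>)\<close>.\<close>

definition twisted_action :: "('g \<Rightarrow> complex mat) \<Rightarrow> ('g \<Rightarrow> int) \<Rightarrow> 'g \<Rightarrow> laurent mat" where
  "twisted_action \<alpha> \<epsilon> g = map_mat (Poly_Mapping.single (\<epsilon> g)) (\<alpha> g)"

text \<open>A singular chain with local coefficients assigns to a simplex \<open>\<sigma>\<close> an element of the fibre of
  the local system over the vertex \<open>\<sigma>(e\<^sub>0)\<close>. Each fibre is identified with the fibre
  \<open>\<complex>\<^sup>n \<otimes> \<complex>[t\<^sup>\<plusminus>\<^sup>1]\<close> over the base point by a chosen path; another choice changes the chain complex by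
  an isomorphism. A generator \<open>(\<sigma>, j)\<close> below stands for \<open>\<sigma> \<otimes> e\<^sub>j\<close>. Only the 0-th face moves the
  initial vertex, from \<open>x = \<sigma>(e\<^sub>0)\<close> to \<open>y = \<sigma>(e\<^sub>1)\<close>. With \<open>\<gamma>\<^sub>x\<close>, \<open>\<gamma>\<^sub>y\<close> the chosen paths and \<open>\<delta>\<close>
  the edge from \<open>x\<close> to \<open>y\<close>, transport from the fibre over \<open>y\<close> to that over \<open>x\<close> is the action
  of \<open>[\<gamma>\<^sub>x \<delta> \<gamma>\<^sub>y\<^sup>-\<^sup>1]\<close>, so the 0-th face carries the action of the inverse \<open>[\<gamma>\<^sub>y \<delta>\<^sup>-\<^sup>1 \<gamma>\<^sub>x\<^sup>-\<^sup>1]\<close>. This is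
  \<open>C\<^sub>*(universal cover) \<otimes>\<^bsub>\<int>[\<pi>]\<^esub> (\<complex>\<^sup>n \<otimes> \<complex>[t\<^sup>\<plusminus>\<^sup>1])\<close>, where \<open>g \<sigma> \<otimes> g v = \<sigma> \<otimes> v\<close>.\<close>

type_synonym 'a twisted_chain = "((nat \<Rightarrow> real) \<Rightarrow> 'a) \<times> nat \<Rightarrow>\<^sub>0 laurent"

definition basing_path :: "'a::topological_space set \<Rightarrow> 'a \<Rightarrow> 'a \<Rightarrow> real \<Rightarrow> 'a" where
  "basing_path N x0 x = (SOME p. path p \<and> path_image p \<subseteq> N \<and> pathstart p = x0 \<and> pathfinish p = x)"

definition first_edge :: "((nat \<Rightarrow> real) \<Rightarrow> 'a) \<Rightarrow> real \<Rightarrow> 'a" where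
  "first_edge \<sigma> s = \<sigma> (\<lambda>i. if i = 0 then 1 - s else if i = 1 then s else 0)"

definition transport_class ::
    "'a::topological_space set \<Rightarrow> 'a \<Rightarrow> ((nat \<Rightarrow> real) \<Rightarrow> 'a) \<Rightarrow> (real \<Rightarrow> 'a) set" where
  "transport_class N x0 \<sigma> =
     path_class N (basing_path N x0 (first_edge \<sigma> 1) +++
       (reversepath (first_edge \<sigma>) +++ reversepath (basing_path N x0 (first_edge \<sigma> 0))))"

definition twisted_chains :: "'a::topological_space set \<Rightarrow> nat \<Rightarrow> nat \<Rightarrow> 'a twisted_chain set" where
  "twisted_chains N n p =
     {c. Poly_Mapping.keys c \<subseteq> singular_simplex_set p (top_of_set N) \<times> {..<n}}"

definition chain_smult :: "laurent \<Rightarrow> 'a twisted_chain \<Rightarrow> 'a twisted_chain" where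
  "chain_smult a c = Poly_Mapping.map ((*) a) c"

definition generator_boundary ::
    "'a::topological_space set \<Rightarrow> 'a \<Rightarrow> nat \<Rightarrow> ((real \<Rightarrow> 'a) set \<Rightarrow> laurent mat) \<Rightarrow> nat
      \<Rightarrow> ((nat \<Rightarrow> real) \<Rightarrow> 'a) \<Rightarrow> nat \<Rightarrow> 'a twisted_chain" where
  "generator_boundary N x0 n \<rho> p \<sigma> j =
     (\<Sum>i<n. Poly_Mapping.single (singular_face p 0 \<sigma>, i) (\<rho> (transport_class N x0 \<sigma>) $$ (i, j))) +
     (\<Sum>k=1..p. Poly_Mapping.single (singular_face p k \<sigma>, j) ((-1) ^ k))"

definition twisted_boundary ::
    "'a::topological_space set \<Rightarrow> 'a \<Rightarrow> nat \<Rightarrow> ((real \<Rightarrow> 'a) set \<Rightarrow> laurent mat) \<Rightarrow> nat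
      \<Rightarrow> 'a twisted_chain \<Rightarrow> 'a twisted_chain" where
  "twisted_boundary N x0 n \<rho> p c =
     (if p = 0 then 0
      else \<Sum>x\<in>Poly_Mapping.keys c.
             chain_smult (Poly_Mapping.lookup c x) (generator_boundary N x0 n \<rho> p (fst x) (snd x)))"

definition twisted_cycle_module ::
    "'a::topological_space set \<Rightarrow> 'a \<Rightarrow> nat \<Rightarrow> ((real \<Rightarrow> 'a) set \<Rightarrow> laurent mat) \<Rightarrow> nat
      \<Rightarrow> (laurent, 'a twisted_chain) module" where
  "twisted_cycle_module N x0 n \<rho> p =
     \<lparr>carrier = {c \<in> twisted_chains N n p. twisted_boundary N x0 n \<rho> p c = 0},
      monoid.mult = (\<lambda>_ _. 0), one = 0, zero = 0, add = (+), module.smult = chain_smult\<rparr>"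

definition twisted_homology ::
    "'a::topological_space set \<Rightarrow> 'a \<Rightarrow> nat \<Rightarrow> ((real \<Rightarrow> 'a) set \<Rightarrow> laurent mat) \<Rightarrow> nat
      \<Rightarrow> (laurent, 'a twisted_chain set) module" where
  "twisted_homology N x0 n \<rho> p =
     quotient_module (twisted_cycle_module N x0 n \<rho> p)
       (twisted_boundary N x0 n \<rho> (Suc p) ` twisted_chains N n (Suc p))"

text \<open>\<open>\<Delta>\<close> represents the \<open>i\<close>-th twisted Alexander polynomial of \<open>\<alpha>\<close>.\<close>

definition is_twisted_alexander_polynomial ::
    "'a::topological_space set \<Rightarrow> 'a \<Rightarrow> ((real \<Rightarrow> 'a) set \<Rightarrow> int) \<Rightarrow> nat
      \<Rightarrow> ((real \<Rightarrow> 'a) set \<Rightarrow> complex mat) \<Rightarrow> nat \<Rightarrow> laurent \<Rightarrow> bool" where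
  "is_twisted_alexander_polynomial N x0 \<epsilon> n \<alpha> i \<Delta> \<longleftrightarrow>
     is_order_of \<Delta> (twisted_homology N x0 n (twisted_action \<alpha> \<epsilon>) i)"

end

theory Submission
  imports Defs "Jordan_Normal_Form.Determinant"
begin

text \<open>The order of a module \<open>\<Oplus>\<^sub>j \<complex>[t\<^sup>\<plusminus>\<^sup>1] / (p\<^sub>j)\<close> depends, up to units, only on the module. Conjugating
  \<open>\<alpha>\<close> by \<open>diag(1, w\<^sup>-\<^sup>1, w\<^sup>-\<^sup>2, \<dots>)\<close> with a primitive \<open>n\<close>-th root of unity \<open>w\<close> multiplies \<open>\<alpha>(g)\<close> by
  \<open>w\<^sup>-\<^sup>\<epsilon>\<^sup>(\<^sup>g\<^sup>)\<close>, which undoes the substitution \<open>t \<mapsto> w t\<close>. Hence the twisted chain complex has an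
  automorphism that is semilinear over \<open>t \<mapsto> w t\<close>, so \<open>\<Delta>(w t)\<close> and \<open>\<Delta>(t)\<close> are orders of the same module
  and \<open>\<Delta>\<close> is a polynomial in \<open>t\<^sup>n\<close> up to a unit. As the exterior is path connected, the zeroth
  homology is the module of coinvariants of \<open>\<complex>\<^sup>n \<otimes> \<complex>[t\<^sup>\<plusminus>\<^sup>1]\<close>. The meridian identifies \<open>e\<^sub>j\<close> with
  \<open>z t e\<^sub>j\<^sub>+\<^sub>1\<close>, so \<open>e\<^sub>0\<close> generates. If \<open>\<chi>\<close> is trivial, the only relation is
  \<open>(1 - z\<^sup>n t\<^sup>n) e\<^sub>0 = 0\<close>; otherwise an element \<open>h\<close> of \<open>H\<close> with \<open>\<chi>(h) \<noteq> 1\<close> kills \<open>e\<^sub>0\<close>.\<close>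

section \<open>Laurent polynomials\<close>

text \<open>Both claims hinge on a zero pattern: the entry (i, j) of \<open>\<alpha> g\<close>
  vanishes unless n divides i - j - \<epsilon>(g). Give t^k e_i the weight i - k modulo n; then the
  boundary preserves weights, and the semilinear automorphism is the operator that acts on weight r
  by w^(-r).

  An order is defined by the mere existence of an isomorphism, so its uniqueness has to be
  established before anything can be compared. Replacing isomorphisms with a direct sum by
  surjections from a free module turns uniqueness into an identity between determinants over an
  integral domain.

  In degree zero the difficulty is that fibres over different points are compared along arbitrarily
  chosen paths. It is met by realising every element of \<pi> as the transport along a singular edge
  from the base point to any prescribed point. The power z^n t^n arises because n meridian steps,
  each contributing z t, lead from e_0 back to itself.\<close>

lemma lookup_laurent_mult:
  fixes p q :: laurent
  shows "Poly_Mapping.lookup (p * q) k =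
    (\<Sum>l\<in>Poly_Mapping.keys p. Poly_Mapping.lookup p l * Poly_Mapping.lookup q (k - l))"
proof -
  have "Sum_any (\<lambda>r. Poly_Mapping.lookup q r when k = l + r) = Poly_Mapping.lookup q (k - l)" for l
  proof -
    have "(\<lambda>r. Poly_Mapping.lookup q r when k = l + r) = (\<lambda>r. Poly_Mapping.lookup q r when r = k - l)"
      by (auto simp: when_def fun_eq_iff)
    then show ?thesis by (simp only: Sum_any_when_equal)
  qed
  then have "Poly_Mapping.lookup (p * q) k = Sum_any (\<lambda>l. Poly_Mapping.lookup p l * Poly_Mapping.lookup q (k - l))"
    by (simp add: lookup_mult)
  also have "\<dots> = (\<Sum>l\<in>Poly_Mapping.keys p. Poly_Mapping.lookup p l * Poly_Mapping.lookup q (k - l))"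
    by (rule Sum_any.expand_superset) (auto simp: in_keys_iff)
  finally show ?thesis .
qed

lemma lookup_single_laurent_mult:
  "Poly_Mapping.lookup (Poly_Mapping.single j c * q) k = c * Poly_Mapping.lookup (q :: laurent) (k - j)"
  by (cases "c = 0") (auto simp: lookup_laurent_mult)

text \<open>At most one summand of the convolution survives when the exponent splits in only one
  way. This is applied to the extreme exponents of a product, where no cancellation can
  occur.\<close>

lemma lookup_laurent_mult_unique:
  fixes p q :: laurent
  assumes "\<And>x y. x \<in> Poly_Mapping.keys p \<Longrightarrow> y \<in> Poly_Mapping.keys q \<Longrightarrow> x + y = a + b \<Longrightarrow> x = a"
  shows "Poly_Mapping.lookup (p * q) (a + b) = Poly_Mapping.lookup p a * Poly_Mapping.lookup q b"
proof -
  have "Poly_Mapping.lookup (p * q) (a + b) =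
      (\<Sum>l\<in>Poly_Mapping.keys p. if l = a then Poly_Mapping.lookup p a * Poly_Mapping.lookup q b else 0)"
    unfolding lookup_laurent_mult
  proof (rule sum.cong)
    fix l assume l: "l \<in> Poly_Mapping.keys p"
    show "Poly_Mapping.lookup p l * Poly_Mapping.lookup q (a + b - l) =
        (if l = a then Poly_Mapping.lookup p a * Poly_Mapping.lookup q b else 0)"
      using assms[OF l, of "a + b - l"] by (auto simp: in_keys_iff)
  qed simp
  then show ?thesis by (auto simp: in_keys_iff)
qed

text \<open>The lowest and the highest exponents of u and v add up to exponents of u v = 1, so both
  sums are 0. Hence the lowest and highest exponents of u coincide.\<close>

lemma laurent_unit_monomial:
  fixes u v :: laurent
  assumes uv: "u * v = 1"
  shows "\<exists>c k. c \<noteq> 0 \<and> u = Poly_Mapping.single k c"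
proof -
  let ?U = "Poly_Mapping.keys u" and ?V = "Poly_Mapping.keys v"
  have ne: "?U \<noteq> {}" "?V \<noteq> {}"
    using uv by auto
  have "Poly_Mapping.lookup (u * v) (Min ?U + Min ?V) = Poly_Mapping.lookup u (Min ?U) * Poly_Mapping.lookup v (Min ?V)"
  proof (rule lookup_laurent_mult_unique)
    fix x y assume "x \<in> ?U" "y \<in> ?V" "x + y = Min ?U + Min ?V"
    moreover from this have "Min ?U \<le> x" "Min ?V \<le> y" by (auto intro: Min_le)
    ultimately show "x = Min ?U" by linarith
  qed
  moreover have "Poly_Mapping.lookup (u * v) (Max ?U + Max ?V) = Poly_Mapping.lookup u (Max ?U) * Poly_Mapping.lookup v (Max ?V)"
  proof (rule lookup_laurent_mult_unique)
    fix x y assume "x \<in> ?U" "y \<in> ?V" "x + y = Max ?U + Max ?V"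
    moreover from this have "x \<le> Max ?U" "y \<le> Max ?V" by (auto intro: Max_ge)
    ultimately show "x = Max ?U" by linarith
  qed
  ultimately have "Poly_Mapping.lookup (1::laurent) (Min ?U + Min ?V) \<noteq> 0"
      "Poly_Mapping.lookup (1::laurent) (Max ?U + Max ?V) \<noteq> 0"
    using ne uv by (auto simp flip: in_keys_iff)
  then have "Min ?U + Min ?V = 0" "Max ?U + Max ?V = 0"
    by (auto simp: lookup_one when_def split: if_splits)
  moreover have "Min ?U \<le> Max ?U" "Min ?V \<le> Max ?V"
    using ne by auto
  ultimately have eq: "Min ?U = Max ?U" by linarith
  have "k = Max ?U" if "k \<in> ?U" for k
    using that Min_le[of ?U k] Max_ge[of ?U k] eq by (intro antisym) auto
  then have "u = Poly_Mapping.single (Max ?U) (Poly_Mapping.lookup u (Max ?U))"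
    by (intro poly_mapping_eqI) (auto simp: lookup_single when_def in_keys_iff)
  moreover have "Poly_Mapping.lookup u (Max ?U) \<noteq> 0"
    using ne by (auto simp flip: in_keys_iff)
  ultimately show ?thesis by blast
qed

lemma single_mult_single_inverse:
  "(c::complex) \<noteq> 0 \<Longrightarrow> Poly_Mapping.single (- k) (1 / c) * Poly_Mapping.single (k::int) c = 1"
  by (simp add: mult_single)

text \<open>Mutual divisibility is the form in which the comparison of determinants delivers its
  result. Cancelling q leaves a product equal to 1, whose factors are monomials.\<close>

lemma equal_up_to_unit_iff_dvd: "equal_up_to_unit p q \<longleftrightarrow> p dvd q \<and> q dvd p"
proof
  assume "equal_up_to_unit p q"
  then obtain c k where c: "c \<noteq> 0" and p: "p = Poly_Mapping.single k c * q"
    unfolding equal_up_to_unit_def by blast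
  have "q = Poly_Mapping.single (- k) (1 / c) * p"
    unfolding p mult.assoc[symmetric] single_mult_single_inverse[OF c] by simp
  with p show "p dvd q \<and> q dvd p"
    by (metis dvd_triv_right)
next
  assume "p dvd q \<and> q dvd p"
  then obtain u v where uv: "q = p * u" "p = q * v"
    by (metis dvdE)
  show "equal_up_to_unit p q"
  proof (cases "q = 0")
    case True
    with uv show ?thesis
      unfolding equal_up_to_unit_def by (intro exI[of _ 1]) auto
  next
    case False
    from uv have "q * (v * u) = q * 1" by (simp add: mult.assoc)
    with False have "v * u = 1" by (metis mult_left_cancel)
    with uv(2) show ?thesis
      unfolding equal_up_to_unit_def using laurent_unit_monomial[of v u] by (metis mult.commute)
  qed
qed

text \<open>This is the substitution t -> w t, that is p(w t). For nonzero w it is a ring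
  automorphism with inverse \<open>rescale (inverse w)\<close>.\<close>

definition rescale :: "complex \<Rightarrow> laurent \<Rightarrow> laurent" where
  "rescale w p = Poly_Mapping.mapp (\<lambda>k c. w powi k * c) p"

lemma lookup_rescale [simp]:
  "Poly_Mapping.lookup (rescale w p) k = w powi k * Poly_Mapping.lookup p k"
  by (auto simp: rescale_def lookup_mapp when_def in_keys_iff)

lemma keys_rescale [simp]: "w \<noteq> 0 \<Longrightarrow> Poly_Mapping.keys (rescale w p) = Poly_Mapping.keys p"
  by (auto simp: in_keys_iff)

lemma rescale_add [simp]: "rescale w (p + q) = rescale w p + rescale w q"
  by (rule poly_mapping_eqI) (simp add: lookup_add algebra_simps)

lemma rescale_0 [simp]: "rescale w 0 = 0"
  by (rule poly_mapping_eqI) simp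

lemma rescale_diff [simp]: "rescale w (p - q) = rescale w p - rescale w q"
  by (rule poly_mapping_eqI) (simp add: lookup_minus algebra_simps)

lemma rescale_minus [simp]: "rescale w (- p) = - rescale w p"
  by (rule poly_mapping_eqI) simp

lemma rescale_single [simp]: "rescale w (Poly_Mapping.single k c) = Poly_Mapping.single k (w powi k * c)"
  by (rule poly_mapping_eqI) (auto simp: lookup_single when_def)

lemma rescale_1 [simp]: "rescale w 1 = 1"
  by (simp flip: single_one)

lemma rescale_mult [simp]:
  assumes "w \<noteq> 0"
  shows "rescale w (p * q) = rescale w p * rescale w q"
proof (rule poly_mapping_eqI)
  fix k
  show "Poly_Mapping.lookup (rescale w (p * q)) k = Poly_Mapping.lookup (rescale w p * rescale w q) k"
    using assms
    by (simp add: lookup_laurent_mult sum_distrib_left power_int_diff field_simps)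
qed

lemma rescale_inverse [simp]: "w \<noteq> 0 \<Longrightarrow> rescale w (rescale (inverse w) p) = p"
    and rescale_inverse' [simp]: "w \<noteq> 0 \<Longrightarrow> rescale (inverse w) (rescale w p) = p"
  by (rule poly_mapping_eqI; simp add: power_int_inverse)+

lemma rescale_dvd_iff:
  assumes "w \<noteq> 0"
  shows "rescale w p dvd q \<longleftrightarrow> p dvd rescale (inverse w) q"
proof
  assume "rescale w p dvd q"
  then obtain r where "q = rescale w p * r" by (auto simp: dvd_def)
  then have "rescale (inverse w) q = p * rescale (inverse w) r" using assms by simp
  then show "p dvd rescale (inverse w) q" by simp
next
  assume "p dvd rescale (inverse w) q"
  then obtain r where r: "rescale (inverse w) q = p * r" by (auto simp: dvd_def)
  have "q = rescale w (rescale (inverse w) q)" using assms by simp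
  also have "\<dots> = rescale w p * rescale w r" unfolding r using assms by simp
  finally show "rescale w p dvd q" by simp
qed

lemma rescale_prod_list: "w \<noteq> 0 \<Longrightarrow> rescale w (prod_list ps) = prod_list (map (rescale w) ps)"
  by (induction ps) simp_all

section \<open>Polynomials in t^n as invariants of t -> w t\<close>

lemma lookup_poly_in_t_power:
  assumes n: "n \<ge> 1"
  shows "Poly_Mapping.lookup (poly_in_t_power n q) k =
    (if k \<ge> 0 \<and> int n dvd k then Polynomial.coeff q (nat (k div int n)) else 0)"
proof -
  have "Poly_Mapping.lookup (poly_in_t_power n q) k =
      (\<Sum>i\<le>Polynomial.degree q. if int (n * i) = k then Polynomial.coeff q i else 0)"
    by (simp only: poly_in_t_power_def lookup_sum lookup_single when_def)
  also have "\<dots> = (if k \<ge> 0 \<and> int n dvd k then Polynomial.coeff q (nat (k div int n)) else 0)"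
  proof (cases "k \<ge> 0 \<and> int n dvd k")
    case True
    define m where "m = nat (k div int n)"
    have "int m = k div int n"
      unfolding m_def using True n by (simp add: pos_imp_zdiv_nonneg_iff)
    with True have k: "k = int (n * m)" by simp
    have "(int (n * i) = k) = (i = m)" for i
      unfolding k of_nat_eq_iff using n by simp
    then have "(\<Sum>i\<le>Polynomial.degree q. if int (n * i) = k then Polynomial.coeff q i else 0) = Polynomial.coeff q m"
      by (simp only: sum.delta finite_atMost) (simp add: coeff_eq_0)
    then show ?thesis unfolding if_P[OF True] m_def .
  next
    case False
    have "int (n * i) \<noteq> k" for i
    proof
      assume "int (n * i) = k"
      then have "k = int n * int i" by simp
      then have "k \<ge> 0" "int n dvd k" by (simp_all only: dvd_triv_left) simp
      then show False using False by blast
    qed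
    then show ?thesis unfolding if_not_P[OF False] by (simp only: if_False sum.neutral_const)
  qed
  finally show ?thesis .
qed

text \<open>If \<open>w\<close> is a primitive \<open>n\<close>-th root of unity, then \<open>p(w t) = c t\<^sup>k p(t)\<close> forces \<open>k = 0\<close> and
  \<open>w\<^sup>i = c\<close> for every exponent \<open>i\<close> of \<open>p\<close>, so the exponents agree modulo \<open>n\<close>.\<close>

lemma poly_in_t_power_if_rescale_invariant:
  assumes n: "n \<ge> 1" and w: "\<And>k::int. w powi k = 1 \<longleftrightarrow> int n dvd k"
    and p: "equal_up_to_unit (rescale w p) p"
  shows "\<exists>q. equal_up_to_unit p (poly_in_t_power n q)"
proof (cases "p = 0")
  case True
  then have "equal_up_to_unit p (poly_in_t_power n 0)"
    by (simp add: equal_up_to_unit_iff_dvd poly_in_t_power_def)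
  then show ?thesis by blast
next
  case False
  let ?K = "Poly_Mapping.keys p"
  define a where "a = Min ?K"
  have ne: "?K \<noteq> {}" using False by simp
  have w0: "w \<noteq> 0"
  proof
    assume "w = 0"
    moreover have "w powi int n = 1" by (simp only: w dvd_refl)
    ultimately show False using n by (simp add: power_0_left)
  qed
  from p obtain c k where c: "c \<noteq> 0" and eq: "rescale w p = Poly_Mapping.single k c * p"
    by (auto simp: equal_up_to_unit_def)
  have lk: "w powi i * Poly_Mapping.lookup p i = c * Poly_Mapping.lookup p (i - k)" for i
    using arg_cong[OF eq, of "\<lambda>r. Poly_Mapping.lookup r i"] by (simp add: lookup_single_laurent_mult)
  have shift: "i \<in> ?K \<longleftrightarrow> i - k \<in> ?K" for i
    using lk[of i] c w0 by (auto simp: in_keys_iff)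
  \<comment> \<open>The set of exponents is finite, nonempty and stable under the shift by k in both
    directions, so its minimum would be undercut unless k = 0.\<close>
  have "k = 0"
  proof -
    have "a \<in> ?K" unfolding a_def using ne by simp
    then have "a - k \<in> ?K" "a + k \<in> ?K" using shift[of a] shift[of "a + k"] by auto
    then have "Min ?K \<le> a - k" "Min ?K \<le> a + k" by (simp_all only: Min_le finite_keys)
    then show ?thesis unfolding a_def by linarith
  qed
  then have c_eq: "w powi i = c" if "i \<in> ?K" for i
    using lk[of i] that by (simp add: in_keys_iff)
  have aK: "a \<in> ?K" unfolding a_def using ne by simp
  have cong: "i \<ge> a \<and> int n dvd (i - a)" if "i \<in> ?K" for i
  proof
    show "i \<ge> a" unfolding a_def using that by simp
    have "w powi (i - a) = 1"
      using c_eq[OF that] c_eq[OF aK] w0 c by (simp add: power_int_diff)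
    then show "int n dvd (i - a)" using w by simp
  qed
  \<comment> \<open>Dividing by t^a with a the lowest exponent leaves only nonnegative multiples of
    n as exponents; t^a is the unit in the conclusion.\<close>
  define q where "q = Abs_poly (\<lambda>m. Poly_Mapping.lookup p (a + int (n * m)))"
  have "finite {m. Poly_Mapping.lookup p (a + int (n * m)) \<noteq> 0}"
  proof (rule finite_subset)
    show "{m. Poly_Mapping.lookup p (a + int (n * m)) \<noteq> 0} \<subseteq> (\<lambda>i. nat ((i - a) div int n)) ` ?K"
    proof
      fix m assume "m \<in> {m. Poly_Mapping.lookup p (a + int (n * m)) \<noteq> 0}"
      then have "a + int (n * m) \<in> ?K" by (simp add: in_keys_iff)
      moreover have "m = nat ((a + int (n * m) - a) div int n)" using n by simp
      ultimately show "m \<in> (\<lambda>i. nat ((i - a) div int n)) ` ?K" by (rule rev_image_eqI)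
    qed
  qed simp
  then have coeff: "Polynomial.coeff q m = Poly_Mapping.lookup p (a + int (n * m))" for m
    unfolding q_def by (subst Abs_poly_inverse) (auto simp: MOST_iff_cofinite)
  have "p = Poly_Mapping.single a 1 * poly_in_t_power n q"
  proof (rule poly_mapping_eqI)
    fix i
    have "a + int (n * nat ((i - a) div int n)) = i" if "i \<ge> a" "int n dvd (i - a)"
      using that n by (simp add: pos_imp_zdiv_nonneg_iff)
    moreover have "Poly_Mapping.lookup p i = 0" if "\<not> (i \<ge> a \<and> int n dvd (i - a))"
      using cong[of i] that by (auto simp: in_keys_iff)
    ultimately show "Poly_Mapping.lookup p i = Poly_Mapping.lookup (Poly_Mapping.single a 1 * poly_in_t_power n q) i"
      by (auto simp: lookup_single_laurent_mult lookup_poly_in_t_power[OF n] coeff)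
  qed
  then show ?thesis unfolding equal_up_to_unit_def by (metis one_neq_zero)
qed

section \<open>Diagonal presentations and uniqueness of orders\<close>

text \<open>An isomorphism of M with the sum of the R/(p_j), recorded as the induced surjection from
  R^k. Vectors and matrices thereby replace tuples of cosets. M is a bare record: linearity and the
  kernel condition are the only link between its operations and those of R^k.\<close>

definition diagonal_presentation ::
    "('r::comm_ring_1, 'm) module \<Rightarrow> 'r list \<Rightarrow> ('r Matrix.vec \<Rightarrow> 'm) \<Rightarrow> bool" where
  "diagonal_presentation M ps E \<longleftrightarrow>
     E ` carrier_vec (length ps) = carrier M \<and>
     (\<forall>v\<in>carrier_vec (length ps). \<forall>w\<in>carrier_vec (length ps). E (v + w) = E v \<oplus>\<^bsub>M\<^esub> E w) \<and>
     (\<forall>a. \<forall>v\<in>carrier_vec (length ps). E (a \<cdot>\<^sub>v v) = a \<odot>\<^bsub>M\<^esub> E v) \<and>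
     (\<forall>v\<in>carrier_vec (length ps). \<forall>w\<in>carrier_vec (length ps).
        E v = E w \<longleftrightarrow> (\<forall>j<length ps. ps ! j dvd v $ j - w $ j))"

lemma mult_mat_vec_smult:
  fixes A :: "'r::comm_ring_1 mat"
  assumes "A \<in> carrier_mat m k" "v \<in> carrier_vec k"
  shows "A *\<^sub>v (a \<cdot>\<^sub>v v) = a \<cdot>\<^sub>v (A *\<^sub>v v)"
  using assms by (intro eq_vecI) auto

lemma mult_mat_vec_unit_vec:
  fixes A :: "'r::comm_ring_1 mat"
  assumes "A \<in> carrier_mat m k" "j < k"
  shows "A *\<^sub>v unit_vec k j = col A j"
  using assms by (intro eq_vecI) auto

text \<open>No module axioms are available for M, so its zero is recognised by idempotence: a value
  E u with E u + E u = E u forces every p_j to divide u_j.\<close>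

lemma diagonal_presentation_zero:
  assumes E: "diagonal_presentation M ps E" and F: "diagonal_presentation M qs F"
  shows "F (0\<^sub>v (length qs)) = E (0\<^sub>v (length ps))"
proof -
  have "F (0\<^sub>v (length qs)) \<in> carrier M"
    using F unfolding diagonal_presentation_def by (metis imageI zero_carrier_vec)
  then obtain u where u: "u \<in> carrier_vec (length ps)" "F (0\<^sub>v (length qs)) = E u"
    using E unfolding diagonal_presentation_def by (metis imageE)
  have "E u = F (0\<^sub>v (length qs) + 0\<^sub>v (length qs))" using u by simp
  also have "\<dots> = E u \<oplus>\<^bsub>M\<^esub> E u"
    using F unfolding diagonal_presentation_def u(2)[symmetric] by (blast intro: zero_carrier_vec)
  also have "\<dots> = E (u + u)"
    using E u(1) unfolding diagonal_presentation_def by simp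
  finally have "\<forall>j<length ps. ps ! j dvd (u + u) $ j - u $ j"
    using E u(1) unfolding diagonal_presentation_def by (metis add_carrier_vec)
  then have "\<forall>j<length ps. ps ! j dvd u $ j - 0\<^sub>v (length ps) $ j"
    using u(1) by simp
  then show ?thesis
    using E u unfolding diagonal_presentation_def by (metis zero_carrier_vec)
qed

text \<open>The columns of C are preimages under E of the generators given by F; both maps are
  linear, so agreement on unit vectors spreads to all vectors.\<close>

lemma diagonal_presentation_lift:
  assumes E: "diagonal_presentation M ps E" and F: "diagonal_presentation M qs F"
  obtains C where "C \<in> carrier_mat (length ps) (length qs)"
    "\<And>w. w \<in> carrier_vec (length qs) \<Longrightarrow> F w = E (C *\<^sub>v w)"
proof -
  let ?k = "length ps" and ?l = "length qs"
  have "\<exists>c. c \<in> carrier_vec ?k \<and> F (unit_vec ?l i) = E c" for i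
    using E F unfolding diagonal_presentation_def by (metis imageE imageI unit_vec_carrier)
  then obtain c where c: "\<And>i. c i \<in> carrier_vec ?k" "\<And>i. F (unit_vec ?l i) = E (c i)"
    by metis
  define C where "C = Matrix.mat ?k ?l (\<lambda>(r, i). c i $ r)"
  have C: "C \<in> carrier_mat ?k ?l" by (simp add: C_def)
  have colC: "col C i = c i" if "i < ?l" for i
    using c(1)[of i] that by (intro eq_vecI) (auto simp: C_def)
  have "F w = E (C *\<^sub>v w)" if w: "w \<in> carrier_vec ?l" for w
  proof -
    \<comment> \<open>M offers only a binary sum, so linear extension goes by induction over the
      truncations of w to its first m entries.\<close>
    define t where "t m = Matrix.vec ?l (\<lambda>i. if i < m then w $ i else 0)" for m
    have t: "t m \<in> carrier_vec ?l" for m by (simp add: t_def)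
    have "m \<le> ?l \<Longrightarrow> F (t m) = E (C *\<^sub>v t m)" for m
    proof (induction m)
      case 0
      have t0: "t 0 = 0\<^sub>v ?l" by (auto simp: t_def)
      have "C *\<^sub>v 0\<^sub>v ?l = 0\<^sub>v ?k" using C by (intro eq_vecI) auto
      then show ?case
        unfolding t0 using diagonal_presentation_zero[OF E F] by simp
    next
      case (Suc m)
      have tS: "t (Suc m) = t m + w $ m \<cdot>\<^sub>v unit_vec ?l m"
        using Suc.prems by (intro eq_vecI) (auto simp: t_def less_Suc_eq)
      have Cm: "C *\<^sub>v unit_vec ?l m = c m"
        using Suc.prems mult_mat_vec_unit_vec[OF C, of m] colC[of m] by simp
      have "F (t (Suc m)) = F (t m) \<oplus>\<^bsub>M\<^esub> w $ m \<odot>\<^bsub>M\<^esub> F (unit_vec ?l m)"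
        unfolding tS using F t unfolding diagonal_presentation_def by simp
      also have "\<dots> = E (C *\<^sub>v t m) \<oplus>\<^bsub>M\<^esub> w $ m \<odot>\<^bsub>M\<^esub> E (c m)"
        using Suc c(2) by simp
      also have "\<dots> = E (C *\<^sub>v t m + w $ m \<cdot>\<^sub>v c m)"
        using E t C c(1) unfolding diagonal_presentation_def by simp
      also have "C *\<^sub>v t m + w $ m \<cdot>\<^sub>v c m = C *\<^sub>v t (Suc m)"
        unfolding tS using C t[of m] Cm
        by (simp add: mult_add_distrib_mat_vec[of _ ?k ?l] mult_mat_vec_smult[of _ ?k ?l])
      finally show ?case .
    qed
    moreover have "t ?l = w" using w by (auto simp: t_def)
    ultimately show ?thesis by (metis order_refl)
  qed
  with C show ?thesis by (rule that)
qed

lemma det_mat_diag_nth: "det (mat_diag (length ps) (\<lambda>i. ps ! i)) = prod_list (ps :: 'r::comm_ring_1 list)"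
proof -
  have "det (mat_diag (length ps) (\<lambda>i. ps ! i)) = prod_list (diag_mat (mat_diag (length ps) (\<lambda>i. ps ! i)))"
    by (rule det_upper_triangular[of _ "length ps"]) (auto simp: mat_diag_def)
  also have "diag_mat (mat_diag (length ps) (\<lambda>i. ps ! i)) = ps"
    unfolding diag_mat_def by (rule nth_equalityI) (auto simp: mat_diag_def)
  finally show ?thesis .
qed

lemma mat_diag_factor:
  fixes B :: "'r::comm_ring_1 mat"
  assumes B: "B \<in> carrier_mat (length ps) m"
    and dvd: "\<And>i j. i < length ps \<Longrightarrow> j < m \<Longrightarrow> ps ! i dvd B $$ (i, j)"
  obtains Z where "Z \<in> carrier_mat (length ps) m" "B = mat_diag (length ps) (\<lambda>i. ps ! i) * Z"
proof -
  have "\<forall>i j. \<exists>x. i < length ps \<longrightarrow> j < m \<longrightarrow> B $$ (i, j) = ps ! i * x"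
    using dvd by (metis dvdE)
  then obtain x where x: "\<And>i j. i < length ps \<Longrightarrow> j < m \<Longrightarrow> B $$ (i, j) = ps ! i * x i j"
    by metis
  let ?Z = "Matrix.mat (length ps) m (\<lambda>(i, j). x i j)"
  have "B = mat_diag (length ps) (\<lambda>i. ps ! i) * ?Z"
    using B x by (subst mat_diag_mult_left[of _ _ m]) auto
  then show ?thesis by (rule that[rotated]) simp
qed

text \<open>Let \<open>P\<close>, \<open>Q\<close> be the diagonal matrices of \<open>ps\<close>, \<open>qs\<close>, and let \<open>C\<close>, \<open>A\<close> express either set of
  generators by the other. Relations give \<open>1 - C A = P Z\<close> and \<open>C Q = P Y\<close>. Both \<open>(P, -C; 0, 1)\<close> and
  \<open>(1, 0; -A, Q)\<close> present the relations among all generators taken together, and the latter is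
  the former times \<open>(Z, Y; -A, Q)\<close>; now take determinants.\<close>

lemma diagonal_presentation_prod_dvd:
  fixes ps qs :: "'r::idom list"
  assumes E: "diagonal_presentation M ps E" and F: "diagonal_presentation M qs F"
  shows "prod_list ps dvd prod_list qs"
proof -
  let ?k = "length ps" and ?l = "length qs"
  let ?P = "mat_diag ?k (\<lambda>i. ps ! i)" and ?Q = "mat_diag ?l (\<lambda>i. qs ! i)"
  obtain C where C: "C \<in> carrier_mat ?k ?l" and FC: "\<And>w. w \<in> carrier_vec ?l \<Longrightarrow> F w = E (C *\<^sub>v w)"
    using diagonal_presentation_lift[OF E F] by blast
  obtain A where A: "A \<in> carrier_mat ?l ?k" and EA: "\<And>v. v \<in> carrier_vec ?k \<Longrightarrow> E v = F (A *\<^sub>v v)"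
    using diagonal_presentation_lift[OF F E] by blast
  have P: "?P \<in> carrier_mat ?k ?k" and Q: "?Q \<in> carrier_mat ?l ?l" by auto
  have dvd: "ps ! i dvd v $ i - w $ i" if "E v = E w" "v \<in> carrier_vec ?k" "w \<in> carrier_vec ?k" "i < ?k" for v w i
    using E that unfolding diagonal_presentation_def by blast
  obtain Z where Z: "Z \<in> carrier_mat ?k ?k" and PZ: "1\<^sub>m ?k - C * A = ?P * Z"
  proof (rule mat_diag_factor[of "1\<^sub>m ?k - C * A" ps ?k])
    show "1\<^sub>m ?k - C * A \<in> carrier_mat ?k ?k" using C A by auto
    fix i j assume ij: "i < ?k" "j < ?k"
    let ?u = "unit_vec ?k j"
    \<comment> \<open>Rewriting a generator through F and back through E does not change its image,
      so the j-th column of 1 - C A is a relation for E.\<close>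
    have "E ?u = E ((C * A) *\<^sub>v ?u)"
      using EA[of ?u] FC[of "A *\<^sub>v ?u"] A C by (simp add: assoc_mult_mat_vec[of C ?k ?l A ?k])
    moreover have CA: "C * A \<in> carrier_mat ?k ?k" using C A by simp
    ultimately have "ps ! i dvd ?u $ i - ((C * A) *\<^sub>v ?u) $ i"
      by (intro dvd) (use ij in auto)
    also have "((C * A) *\<^sub>v ?u) $ i = (C * A) $$ (i, j)"
      using carrier_matD[OF CA] ij by (simp add: mult_mat_vec_unit_vec[OF CA])
    finally show "ps ! i dvd (1\<^sub>m ?k - C * A) $$ (i, j)"
      using carrier_matD[OF CA] carrier_matD[OF C] carrier_matD[OF A] ij by (simp add: unit_vec_def)
  qed
  obtain Y where Y: "Y \<in> carrier_mat ?k ?l" and PY: "C * ?Q = ?P * Y"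
  proof (rule mat_diag_factor[of "C * ?Q" ps ?l])
    show "C * ?Q \<in> carrier_mat ?k ?l" using C by auto
    fix i j assume ij: "i < ?k" "j < ?l"
    let ?u = "unit_vec ?l j"
    have Qu: "?Q *\<^sub>v ?u \<in> carrier_vec ?l" by (simp add: mult_mat_vec_carrier[of _ _ ?l])
    \<comment> \<open>The j-th column of Q is a relation for F; hence C sends it to a relation for
      E.\<close>
    have "qs ! r dvd (?Q *\<^sub>v ?u) $ r - 0\<^sub>v ?l $ r" if "r < ?l" for r
      unfolding mult_mat_vec_unit_vec[OF Q ij(2)] using that ij by (simp add: mat_diag_def)
    moreover have "F (?Q *\<^sub>v ?u) = F (0\<^sub>v ?l) \<longleftrightarrow>
        (\<forall>r<?l. qs ! r dvd (?Q *\<^sub>v ?u) $ r - 0\<^sub>v ?l $ r)"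
      using F Qu unfolding diagonal_presentation_def by (metis zero_carrier_vec)
    ultimately have "F (?Q *\<^sub>v ?u) = F (0\<^sub>v ?l)" by blast
    then have "E ((C * ?Q) *\<^sub>v ?u) = E (0\<^sub>v ?k)"
      using FC[OF Qu] diagonal_presentation_zero[OF E F] C
      by (simp add: assoc_mult_mat_vec[of C ?k ?l ?Q ?l])
    moreover have CQ: "C * ?Q \<in> carrier_mat ?k ?l" using C by simp
    ultimately have "ps ! i dvd ((C * ?Q) *\<^sub>v ?u) $ i - 0\<^sub>v ?k $ i"
      by (intro dvd) (use ij in auto)
    then show "ps ! i dvd (C * ?Q) $$ (i, j)"
      using carrier_matD[OF CQ] ij by (simp add: mult_mat_vec_unit_vec[OF CQ])
  qed
  let ?T = "four_block_mat ?P (- C) (0\<^sub>m ?l ?k) (1\<^sub>m ?l)"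
  let ?U = "four_block_mat Z Y (- A) ?Q"
  have "(- C) * (- A) = C * A" "(- C) * ?Q = - (C * ?Q)"
    using carrier_matD[OF C] carrier_matD[OF A] carrier_matD[OF Q]
    by (intro eq_matI; auto simp: scalar_prod_def sum_negf)+
  then have e: "?P * Z + (- C) * (- A) = 1\<^sub>m ?k" "?P * Y + (- C) * ?Q = 0\<^sub>m ?k ?l"
    unfolding PZ[symmetric] PY[symmetric]
    using carrier_matD[OF C] carrier_matD[OF A] carrier_matD[OF Q] by (auto intro!: eq_matI)
  have e': "0\<^sub>m ?l ?k * Z + 1\<^sub>m ?l * (- A) = - A" "0\<^sub>m ?l ?k * Y + 1\<^sub>m ?l * ?Q = ?Q"
    using Z Y A left_add_zero_mat[OF Q] left_mult_one_mat[OF Q] by auto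
  have "?T * ?U = four_block_mat (1\<^sub>m ?k) (0\<^sub>m ?k ?l) (- A) ?Q"
    using A C by (subst mult_four_block_mat[OF P _ zero_carrier_mat one_carrier_mat Z Y _ Q])
      (simp_all only: e e' uminus_carrier_mat)
  then have "det ?T * det ?U = det (four_block_mat (1\<^sub>m ?k) (0\<^sub>m ?k ?l) (- A) ?Q)"
    using Z by (subst det_mult[symmetric, of _ "?k + ?l"]) auto
  also have "\<dots> = prod_list qs"
    using A by (subst det_four_block_mat_upper_right_zero[of _ ?k _ ?l]) (auto simp: det_mat_diag_nth)
  also have "det ?T = prod_list ps"
    using C by (subst det_four_block_mat_lower_left_zero[of _ ?k _ ?l]) (auto simp: det_mat_diag_nth)
  finally show ?thesis by (metis dvd_triv_left)
qed

lemma diagonal_presentation_transport: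
  fixes ps :: "'b::comm_ring_1 list"
  assumes c: "diagonal_presentation N ps c"
    and f: "bij_betw f (carrier M) (carrier N)"
    and add: "\<And>x y. x \<in> carrier M \<Longrightarrow> y \<in> carrier M \<Longrightarrow> x \<oplus>\<^bsub>M\<^esub> y \<in> carrier M \<and> f (x \<oplus>\<^bsub>M\<^esub> y) = f x \<oplus>\<^bsub>N\<^esub> f y"
    and smult: "\<And>a x. x \<in> carrier M \<Longrightarrow> a \<odot>\<^bsub>M\<^esub> x \<in> carrier M \<and> f (a \<odot>\<^bsub>M\<^esub> x) = a \<odot>\<^bsub>N\<^esub> f x"
  shows "diagonal_presentation M ps (\<lambda>v. inv_into (carrier M) f (c v))"
proof -
  let ?V = "carrier_vec (length ps)" and ?g = "inv_into (carrier M) f"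
  have img: "c ` ?V = carrier N"
    and cadd: "\<And>v w. v \<in> ?V \<Longrightarrow> w \<in> ?V \<Longrightarrow> c (v + w) = c v \<oplus>\<^bsub>N\<^esub> c w"
    and csm: "\<And>a v. v \<in> ?V \<Longrightarrow> c (a \<cdot>\<^sub>v v) = a \<odot>\<^bsub>N\<^esub> c v"
    and ceq: "\<And>v w. v \<in> ?V \<Longrightarrow> w \<in> ?V \<Longrightarrow> c v = c w \<longleftrightarrow> (\<forall>j<length ps. ps ! j dvd v $ j - w $ j)"
    using c unfolding diagonal_presentation_def by blast+
  have cN: "c v \<in> carrier N" if "v \<in> ?V" for v using img that by blast
  have g: "bij_betw ?g (carrier N) (carrier M)" by (rule bij_betw_inv_into[OF f])
  have gM: "?g y \<in> carrier M" if "y \<in> carrier N" for y using g that bij_betwE by blast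
  have fg: "f (?g y) = y" if "y \<in> carrier N" for y
    using f that by (simp add: bij_betw_inv_into_right)
  have gf: "?g (f x) = x" if "x \<in> carrier M" for x
    using f that by (simp add: bij_betw_inv_into_left)
  show ?thesis
    unfolding diagonal_presentation_def
  proof (intro conjI ballI allI)
    show "(\<lambda>v. ?g (c v)) ` ?V = carrier M"
      using img bij_betw_imp_surj_on[OF g] by (metis image_image)
  next
    fix v w :: "'b Matrix.vec" assume vw: "v \<in> ?V" "w \<in> ?V"
    show "?g (c (v + w)) = ?g (c v) \<oplus>\<^bsub>M\<^esub> ?g (c w)"
      using add[of "?g (c v)" "?g (c w)"] gf[of "?g (c v) \<oplus>\<^bsub>M\<^esub> ?g (c w)"] vw
      by (simp add: cadd cN gM fg)
    show "?g (c v) = ?g (c w) \<longleftrightarrow> (\<forall>j<length ps. ps ! j dvd v $ j - w $ j)"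
      using ceq[OF vw] fg cN vw by metis
  next
    fix a and v :: "'b Matrix.vec" assume v: "v \<in> ?V"
    show "?g (c (a \<cdot>\<^sub>v v)) = a \<odot>\<^bsub>M\<^esub> ?g (c v)"
      using smult[of "?g (c v)" a] gf[of "a \<odot>\<^bsub>M\<^esub> ?g (c v)"] v by (simp add: csm cN gM fg)
  qed
qed

text \<open>Both surjections have the same fibres, cut out by the same divisibilities, so E v -> c v
  is well defined and injective.\<close>

lemma module_isomorphic_if_diagonal_presentations:
  assumes E: "diagonal_presentation M ps E" and c: "diagonal_presentation N ps c"
  shows "module_isomorphic R M N"
proof -
  let ?V = "carrier_vec (length ps)"
  define g where "g = inv_into ?V E"
  have g: "g x \<in> ?V" "E (g x) = x" if "x \<in> carrier M" for x
    using E that inv_into_into[of x E ?V] f_inv_into_f[of x E ?V]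
    unfolding g_def diagonal_presentation_def by auto
  have EV: "E v \<in> carrier M" "c v \<in> carrier N" if "v \<in> ?V" for v
    using E c that unfolding diagonal_presentation_def by blast+
  have eq: "E v = E w \<longleftrightarrow> c v = c w" if "v \<in> ?V" "w \<in> ?V" for v w
    using E c that unfolding diagonal_presentation_def by simp
  have cg: "c (g (E v)) = c v" if "v \<in> ?V" for v
    using eq[of "g (E v)" v] g[OF EV(1)[OF that]] that by simp
  show ?thesis
    unfolding module_isomorphic_def
  proof (intro exI[of _ "\<lambda>x. c (g x)"] conjI ballI)
    show "bij_betw (\<lambda>x. c (g x)) (carrier M) (carrier N)"
      unfolding bij_betw_def
    proof
      show "inj_on (\<lambda>x. c (g x)) (carrier M)"
        by (rule inj_onI) (metis eq g)
      have "y \<in> (\<lambda>x. c (g x)) ` carrier M" if y: "y \<in> carrier N" for y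
      proof -
        obtain v where "v \<in> ?V" "y = c v"
          using c y unfolding diagonal_presentation_def by blast
        then show ?thesis using cg EV by (metis image_eqI)
      qed
      then show "(\<lambda>x. c (g x)) ` carrier M = carrier N"
        using g EV by blast
    qed
  next
    fix x y assume xy: "x \<in> carrier M" "y \<in> carrier M"
    have "E (g x + g y) = x \<oplus>\<^bsub>M\<^esub> y"
      using E g xy unfolding diagonal_presentation_def by metis
    then have "c (g (x \<oplus>\<^bsub>M\<^esub> y)) = c (g x + g y)"
      using cg[of "g x + g y"] g xy by simp
    then show "c (g (x \<oplus>\<^bsub>M\<^esub> y)) = c (g x) \<oplus>\<^bsub>N\<^esub> c (g y)"
      using c g xy unfolding diagonal_presentation_def by metis
  next
    fix a x assume x: "x \<in> carrier M"
    have "E (a \<cdot>\<^sub>v g x) = a \<odot>\<^bsub>M\<^esub> x"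
      using E g x unfolding diagonal_presentation_def by metis
    then have "c (g (a \<odot>\<^bsub>M\<^esub> x)) = c (a \<cdot>\<^sub>v g x)"
      using cg[of "a \<cdot>\<^sub>v g x"] g x by simp
    then show "c (g (a \<odot>\<^bsub>M\<^esub> x)) = a \<odot>\<^bsub>N\<^esub> c (g x)"
      using c g x unfolding diagonal_presentation_def by metis
  qed
qed

section \<open>Cosets of principal ideals and the standard presentation of a direct sum\<close>

lemma cring_laurent_ring: "cring laurent_ring"
proof (rule cringI)
  show "abelian_group laurent_ring"
  proof (rule abelian_groupI)
    show "\<exists>y\<in>carrier laurent_ring. y \<oplus>\<^bsub>laurent_ring\<^esub> x = \<zero>\<^bsub>laurent_ring\<^esub>" for x
      by (rule bexI[of _ "- x"]) (simp_all add: laurent_ring_def)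
  qed (simp_all add: laurent_ring_def algebra_simps)
  show "comm_monoid laurent_ring"
    by (rule comm_monoidI) (simp_all add: laurent_ring_def algebra_simps)
qed (simp add: laurent_ring_def algebra_simps)

abbreviation laurent_coset :: "laurent \<Rightarrow> laurent \<Rightarrow> laurent set" where
  "laurent_coset p a \<equiv> PIdl\<^bsub>laurent_ring\<^esub> p +>\<^bsub>laurent_ring\<^esub> a"

lemma laurent_coset_eq: "laurent_coset p a = {x * p + a | x. True}"
  by (auto simp: a_r_coset_def' cgenideal_def laurent_ring_def)

lemma laurent_coset_eq_iff: "laurent_coset p a = laurent_coset p b \<longleftrightarrow> p dvd a - b"
proof
  assume "laurent_coset p a = laurent_coset p b"
  moreover have "a \<in> laurent_coset p a"
    unfolding laurent_coset_eq by (auto intro: exI[of _ 0])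
  ultimately obtain x where "a = x * p + b" unfolding laurent_coset_eq by auto
  then show "p dvd a - b" by simp
next
  assume "p dvd a - b"
  then obtain r where "a - b = p * r" by (rule dvdE)
  then have a: "a = r * p + b" by (simp add: algebra_simps)
  have "\<exists>x'. x * p + a = x' * p + b" for x
    unfolding a by (rule exI[of _ "x + r"]) (simp add: algebra_simps)
  moreover have "\<exists>x'. x * p + b = x' * p + a" for x
    unfolding a by (rule exI[of _ "x - r"]) (simp add: algebra_simps)
  ultimately show "laurent_coset p a = laurent_coset p b"
    unfolding laurent_coset_eq by auto
qed

lemma laurent_coset_add:
  "laurent_coset p a \<oplus>\<^bsub>laurent_ring Quot PIdl\<^bsub>laurent_ring\<^esub> p\<^esub> laurent_coset p b = laurent_coset p (a + b)"
proof -
  have "laurent_coset p a <+>\<^bsub>laurent_ring\<^esub> laurent_coset p b = laurent_coset p (a + b)"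
  proof (intro subset_antisym subsetI)
    fix y assume "y \<in> laurent_coset p a <+>\<^bsub>laurent_ring\<^esub> laurent_coset p b"
    then obtain u v where "y = (u * p + a) + (v * p + b)"
      unfolding laurent_coset_eq by (auto simp: set_add_def' laurent_ring_def)
    then have "y = (u + v) * p + (a + b)" by (simp add: algebra_simps)
    then show "y \<in> laurent_coset p (a + b)" unfolding laurent_coset_eq by blast
  next
    fix y assume "y \<in> laurent_coset p (a + b)"
    then obtain u where "y = (u * p + a) + (0 * p + b)"
      unfolding laurent_coset_eq by (auto simp: algebra_simps)
    moreover have "u * p + a \<in> laurent_coset p a" "0 * p + b \<in> laurent_coset p b"
      unfolding laurent_coset_eq by blast+
    moreover have "v + w = v \<oplus>\<^bsub>laurent_ring\<^esub> w" for v w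
      by (simp add: laurent_ring_def)
    ultimately show "y \<in> laurent_coset p a <+>\<^bsub>laurent_ring\<^esub> laurent_coset p b"
      unfolding set_add_def' by blast
  qed
  then show ?thesis by (simp add: FactRing_def)
qed

lemma laurent_coset_mult:
  "laurent_coset p a \<otimes>\<^bsub>laurent_ring Quot PIdl\<^bsub>laurent_ring\<^esub> p\<^esub> laurent_coset p b = laurent_coset p (a * b)"
proof -
  interpret cring laurent_ring by (rule cring_laurent_ring)
  interpret ideal "PIdl\<^bsub>laurent_ring\<^esub> p" laurent_ring
    by (rule cgenideal_ideal) (simp add: laurent_ring_def)
  have "[mod (PIdl\<^bsub>laurent_ring\<^esub> p):] (laurent_coset p a) \<Otimes>\<^bsub>laurent_ring\<^esub> (laurent_coset p b) =
      laurent_coset p (a \<otimes>\<^bsub>laurent_ring\<^esub> b)"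
    by (rule rcoset_mult_add) (simp_all add: laurent_ring_def)
  then show ?thesis by (simp add: FactRing_def) (simp add: laurent_ring_def)
qed

lemma diagonal_presentation_cyclic_sum_module:
  "diagonal_presentation (cyclic_sum_module ps) ps
     (\<lambda>v. \<lambda>j\<in>{..<length ps}. laurent_coset (ps ! j) (v $ j))" (is "diagonal_presentation ?M ps ?c")
  unfolding diagonal_presentation_def
proof (intro conjI ballI allI)
  let ?V = "carrier_vec (length ps)"
  have carr: "carrier (laurent_ring Quot PIdl\<^bsub>laurent_ring\<^esub> p) = range (laurent_coset p)" for p
    by (auto simp: FactRing_def A_RCOSETS_def' laurent_ring_def)
  show "?c ` ?V = carrier ?M"
  proof
    show "?c ` ?V \<subseteq> carrier ?M"
      by (auto simp: cyclic_sum_module_def Let_def carr)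
    show "carrier ?M \<subseteq> ?c ` ?V"
    proof
      fix y assume y: "y \<in> carrier ?M"
      then have "\<forall>j. \<exists>a. j < length ps \<longrightarrow> y j = laurent_coset (ps ! j) a"
        by (auto simp: cyclic_sum_module_def Let_def carr PiE_iff)
      then obtain a where a: "\<And>j. j < length ps \<Longrightarrow> y j = laurent_coset (ps ! j) (a j)"
        by metis
      have "y = ?c (Matrix.vec (length ps) a)"
        using y a by (auto simp: cyclic_sum_module_def Let_def PiE_iff extensional_def fun_eq_iff)
      then show "y \<in> ?c ` ?V" by (rule image_eqI) simp
    qed
  qed
next
  fix v w :: "laurent Matrix.vec"
  assume "v \<in> carrier_vec (length ps)" "w \<in> carrier_vec (length ps)"
  then show "?c (v + w) = ?c v \<oplus>\<^bsub>?M\<^esub> ?c w"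
    by (auto simp: cyclic_sum_module_def Let_def laurent_coset_add fun_eq_iff)
  show "?c v = ?c w \<longleftrightarrow> (\<forall>j<length ps. ps ! j dvd v $ j - w $ j)"
    by (auto simp: fun_eq_iff restrict_def laurent_coset_eq_iff[symmetric])
next
  fix a and v :: "laurent Matrix.vec"
  assume "v \<in> carrier_vec (length ps)"
  then show "?c (a \<cdot>\<^sub>v v) = a \<odot>\<^bsub>?M\<^esub> ?c v"
    by (auto simp: cyclic_sum_module_def Let_def laurent_coset_mult fun_eq_iff)
qed

text \<open>Passage from the coset formulation of orders to presentations, where determinants apply.
  Closure of M is what lets the inverse of the isomorphism be used on sums and multiples.\<close>

lemma is_order_of_iff_diagonal_presentation:
  assumes "\<And>x y. x \<in> carrier M \<Longrightarrow> y \<in> carrier M \<Longrightarrow> x \<oplus>\<^bsub>M\<^esub> y \<in> carrier M"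
    and "\<And>a x. x \<in> carrier M \<Longrightarrow> a \<odot>\<^bsub>M\<^esub> x \<in> carrier M"
  shows "is_order_of p M \<longleftrightarrow> (\<exists>ps E. diagonal_presentation M ps E \<and> p = prod_list ps)"
proof
  assume "is_order_of p M"
  then obtain ps f where p: "p = prod_list ps" and "bij_betw f (carrier M) (carrier (cyclic_sum_module ps))"
      "\<forall>x\<in>carrier M. \<forall>y\<in>carrier M. f (x \<oplus>\<^bsub>M\<^esub> y) = f x \<oplus>\<^bsub>cyclic_sum_module ps\<^esub> f y"
      "\<forall>a\<in>carrier laurent_ring. \<forall>x\<in>carrier M. f (a \<odot>\<^bsub>M\<^esub> x) = a \<odot>\<^bsub>cyclic_sum_module ps\<^esub> f x"
    unfolding is_order_of_def module_isomorphic_def by blast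
  moreover have "a \<in> carrier laurent_ring" for a by (simp add: laurent_ring_def)
  ultimately have "diagonal_presentation M ps (\<lambda>v. inv_into (carrier M) f
      (\<lambda>j\<in>{..<length ps}. laurent_coset (ps ! j) (v $ j)))"
    by (intro diagonal_presentation_transport[OF diagonal_presentation_cyclic_sum_module]) (simp_all add: assms)
  with p show "\<exists>ps E. diagonal_presentation M ps E \<and> p = prod_list ps" by blast
next
  assume "\<exists>ps E. diagonal_presentation M ps E \<and> p = prod_list ps"
  then show "is_order_of p M"
    unfolding is_order_of_def
    using module_isomorphic_if_diagonal_presentations[OF _ diagonal_presentation_cyclic_sum_module] by blast
qed

text \<open>The hypotheses on g describe M as R/(q). An arbitrary presentation is compared with the
  one-element list [q]; conversely, an associate p of q imposes the same divisibility, so [p]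
  presents M as well.\<close>

lemma is_order_of_iff_if_cyclic:
  assumes "\<And>x y. x \<in> carrier M \<Longrightarrow> y \<in> carrier M \<Longrightarrow> x \<oplus>\<^bsub>M\<^esub> y \<in> carrier M"
    and "\<And>a x. x \<in> carrier M \<Longrightarrow> a \<odot>\<^bsub>M\<^esub> x \<in> carrier M"
    and g: "range g = carrier M" "\<And>a b. g (a + b) = g a \<oplus>\<^bsub>M\<^esub> g b" "\<And>a b. g (a * b) = a \<odot>\<^bsub>M\<^esub> g b"
      "\<And>a b. g a = g b \<longleftrightarrow> q dvd a - b"
  shows "is_order_of p M \<longleftrightarrow> equal_up_to_unit p q"
proof -
  have pres: "diagonal_presentation M [r] (\<lambda>v. g (v $ 0))" if r: "equal_up_to_unit r q" for r
    unfolding diagonal_presentation_def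
  proof (intro conjI ballI allI)
    have "x \<in> (\<lambda>v. g (v $ 0)) ` carrier_vec (length [r])" if x: "x \<in> carrier M" for x
    proof -
      from x g(1) obtain a where "x = g a" by blast
      then show ?thesis by (intro image_eqI[of _ _ "Matrix.vec 1 (\<lambda>_. a)"]) auto
    qed
    moreover have "g a \<in> carrier M" for a using g(1) by blast
    ultimately show "(\<lambda>v. g (v $ 0)) ` carrier_vec (length [r]) = carrier M" by blast
  qed (use r dvd_trans in \<open>auto simp: g(2,3,4) equal_up_to_unit_iff_dvd\<close>)
  have "is_order_of p M \<longleftrightarrow> (\<exists>ps E. diagonal_presentation M ps E \<and> p = prod_list ps)"
    by (rule is_order_of_iff_diagonal_presentation) (simp_all add: assms(1,2))
  also have "\<dots> \<longleftrightarrow> equal_up_to_unit p q"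
  proof
    assume "\<exists>ps E. diagonal_presentation M ps E \<and> p = prod_list ps"
    then obtain ps E where E: "diagonal_presentation M ps E" and p: "p = prod_list ps" by blast
    have q: "diagonal_presentation M [q] (\<lambda>v. g (v $ 0))"
      by (rule pres) (simp add: equal_up_to_unit_iff_dvd)
    show "equal_up_to_unit p q"
      using diagonal_presentation_prod_dvd[OF E q] diagonal_presentation_prod_dvd[OF q E]
      by (simp add: equal_up_to_unit_iff_dvd p)
  next
    assume "equal_up_to_unit p q"
    from pres[OF this] show "\<exists>ps E. diagonal_presentation M ps E \<and> p = prod_list ps"
      by (intro exI[of _ "[p]"]) auto
  qed
  finally show ?thesis .
qed

text \<open>Precomposing \<psi> E with the substitution t -> t/w on coordinates cancels the two
  semilinearities and yields a linear presentation of the same M. Its relations are the p_j(w t), so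
  uniqueness of orders applies.\<close>

lemma order_rescale_if_semilinear:
  assumes closed: "\<And>x y. x \<in> carrier M \<Longrightarrow> y \<in> carrier M \<Longrightarrow> x \<oplus>\<^bsub>M\<^esub> y \<in> carrier M"
     "\<And>a x. x \<in> carrier M \<Longrightarrow> a \<odot>\<^bsub>M\<^esub> x \<in> carrier M"
    and w: "w \<noteq> 0"
    and \<psi>: "bij_betw \<psi> (carrier M) (carrier M)"
      "\<And>x y. x \<in> carrier M \<Longrightarrow> y \<in> carrier M \<Longrightarrow> \<psi> (x \<oplus>\<^bsub>M\<^esub> y) = \<psi> x \<oplus>\<^bsub>M\<^esub> \<psi> y"
      "\<And>a x. x \<in> carrier M \<Longrightarrow> \<psi> (a \<odot>\<^bsub>M\<^esub> x) = rescale w a \<odot>\<^bsub>M\<^esub> \<psi> x"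
    and p: "is_order_of p M"
  shows "equal_up_to_unit (rescale w p) p"
proof -
  obtain ps E where E: "diagonal_presentation M ps E" and p: "p = prod_list ps"
    using p closed by (subst (asm) is_order_of_iff_diagonal_presentation) auto
  let ?V = "carrier_vec (length ps)"
  let ?r = "map_vec (rescale (inverse w))"
  have img: "E ` ?V = carrier M"
    and Eadd: "\<And>v u. v \<in> ?V \<Longrightarrow> u \<in> ?V \<Longrightarrow> E (v + u) = E v \<oplus>\<^bsub>M\<^esub> E u"
    and Esm: "\<And>a v. v \<in> ?V \<Longrightarrow> E (a \<cdot>\<^sub>v v) = a \<odot>\<^bsub>M\<^esub> E v"
    and Eeq: "\<And>v u. v \<in> ?V \<Longrightarrow> u \<in> ?V \<Longrightarrow> E v = E u \<longleftrightarrow> (\<forall>j<length ps. ps ! j dvd v $ j - u $ j)"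
    using E unfolding diagonal_presentation_def by blast+
  have EM: "E v \<in> carrier M" if "v \<in> ?V" for v using img that by blast
  have w': "inverse w \<noteq> 0" using w by simp
  have r_add: "?r (v + u) = ?r v + ?r u" if "v \<in> ?V" "u \<in> ?V" for v u
    using that by (intro eq_vecI) auto
  have r_sm: "?r (a \<cdot>\<^sub>v v) = rescale (inverse w) a \<cdot>\<^sub>v ?r v" for a v
    using w' by (intro eq_vecI) auto
  have r_surj: "\<exists>u\<in>?V. ?r u = v" if "v \<in> ?V" for v
    using that w by (intro bexI[of _ "map_vec (rescale w) v"] eq_vecI) auto
  have "diagonal_presentation M (map (rescale w) ps) (\<lambda>v. \<psi> (E (?r v)))"
    unfolding diagonal_presentation_def length_map
  proof (intro conjI ballI allI)
    have "?r ` ?V = ?V" using r_surj by auto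
    then have "(\<lambda>v. \<psi> (E (?r v))) ` ?V = \<psi> ` (E ` ?V)" by (metis image_image)
    then show "(\<lambda>v. \<psi> (E (?r v))) ` ?V = carrier M"
      using img \<psi>(1) by (simp add: bij_betw_def)
  next
    fix v u :: "laurent Matrix.vec" assume vu: "v \<in> ?V" "u \<in> ?V"
    then show "\<psi> (E (?r (v + u))) = \<psi> (E (?r v)) \<oplus>\<^bsub>M\<^esub> \<psi> (E (?r u))"
      by (simp add: r_add Eadd \<psi>(2) EM)
    have "\<psi> (E (?r v)) = \<psi> (E (?r u)) \<longleftrightarrow> E (?r v) = E (?r u)"
      using \<psi>(1) EM vu by (auto simp: bij_betw_def inj_on_def)
    also have "\<dots> \<longleftrightarrow> (\<forall>j<length ps. ps ! j dvd rescale (inverse w) (v $ j - u $ j))"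
      using vu by (simp add: Eeq)
    finally show "\<psi> (E (?r v)) = \<psi> (E (?r u)) \<longleftrightarrow>
        (\<forall>j<length ps. map (rescale w) ps ! j dvd v $ j - u $ j)"
      using w by (simp add: rescale_dvd_iff)
  next
    fix a and v :: "laurent Matrix.vec" assume "v \<in> ?V"
    then show "\<psi> (E (?r (a \<cdot>\<^sub>v v))) = a \<odot>\<^bsub>M\<^esub> \<psi> (E (?r v))"
      using w by (simp add: r_sm Esm \<psi>(3) EM)
  qed
  from diagonal_presentation_prod_dvd[OF this E] diagonal_presentation_prod_dvd[OF E this]
  show ?thesis
    using w by (simp add: equal_up_to_unit_iff_dvd p rescale_prod_list)
qed

section \<open>The twisted chain complex\<close>

lemma lookup_chain_smult [simp]:
  "Poly_Mapping.lookup (chain_smult a c) x = a * Poly_Mapping.lookup c x"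
  by (simp add: chain_smult_def Poly_Mapping.map.rep_eq when_def)

lemma chain_smult_add_right: "chain_smult a (c + d) = chain_smult a c + chain_smult a d"
  and chain_smult_add_left: "chain_smult (a + b) c = chain_smult a c + chain_smult b c"
  and chain_smult_diff_right: "chain_smult a (c - d) = chain_smult a c - chain_smult a d"
  and chain_smult_assoc: "chain_smult a (chain_smult b c) = chain_smult (a * b) c"
  and chain_smult_one [simp]: "chain_smult 1 c = c"
  and chain_smult_zero_left [simp]: "chain_smult 0 c = 0"
  and chain_smult_zero_right [simp]: "chain_smult a 0 = 0"
  and chain_smult_single [simp]: "chain_smult a (Poly_Mapping.single x b) = Poly_Mapping.single x (a * b)"
  by (rule poly_mapping_eqI; simp add: lookup_add lookup_minus lookup_single when_def algebra_simps)+

lemma chain_smult_minus_one: "chain_smult (- 1) c = - c"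
  by (rule poly_mapping_eqI) simp

lemma chain_smult_sum: "chain_smult a (\<Sum>x\<in>A. f x) = (\<Sum>x\<in>A. chain_smult a (f x))"
  by (induction A rule: infinite_finite_induct) (simp_all add: chain_smult_add_right)

lemma twisted_chains_add: "c \<in> twisted_chains N n p \<Longrightarrow> d \<in> twisted_chains N n p \<Longrightarrow> c + d \<in> twisted_chains N n p"
  unfolding twisted_chains_def using keys_add[of c d] by blast

lemma twisted_chains_smult: "c \<in> twisted_chains N n p \<Longrightarrow> chain_smult a c \<in> twisted_chains N n p"
  unfolding twisted_chains_def by (auto simp: in_keys_iff subset_iff)

lemma twisted_chains_zero: "0 \<in> twisted_chains N n p"
  by (simp add: twisted_chains_def)

lemma twisted_chains_single:
  "singular_simplex p (top_of_set N) \<sigma> \<Longrightarrow> j < n \<Longrightarrow> Poly_Mapping.single (\<sigma>, j) a \<in> twisted_chains N n p"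
  by (auto simp: twisted_chains_def)

text \<open>The defining sum runs over the support, which changes when chains are added. Summing
  over any finite larger set makes linearity a termwise matter.\<close>

lemma twisted_boundary_superset:
  assumes "finite A" "Poly_Mapping.keys c \<subseteq> A"
  shows "twisted_boundary N x0 n \<rho> p c =
    (if p = 0 then 0 else \<Sum>x\<in>A. chain_smult (Poly_Mapping.lookup c x) (generator_boundary N x0 n \<rho> p (fst x) (snd x)))"
  unfolding twisted_boundary_def using assms
  by (auto intro!: sum.mono_neutral_left simp: in_keys_iff)

lemma twisted_boundary_add:
  "twisted_boundary N x0 n \<rho> p (c + d) = twisted_boundary N x0 n \<rho> p c + twisted_boundary N x0 n \<rho> p d"
proof -
  let ?A = "Poly_Mapping.keys c \<union> Poly_Mapping.keys d"
  have "Poly_Mapping.keys (c + d) \<subseteq> ?A" by (rule keys_add)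
  then show ?thesis
    by (simp add: twisted_boundary_superset[of ?A] chain_smult_add_left lookup_add sum.distrib)
qed

lemma twisted_boundary_smult:
  "twisted_boundary N x0 n \<rho> p (chain_smult a c) = chain_smult a (twisted_boundary N x0 n \<rho> p c)"
proof -
  have "Poly_Mapping.keys (chain_smult a c) \<subseteq> Poly_Mapping.keys c"
    by (auto simp: in_keys_iff)
  then show ?thesis
    by (simp add: twisted_boundary_superset[of "Poly_Mapping.keys c"] chain_smult_sum chain_smult_assoc)
qed

lemma twisted_boundary_single:
  "p > 0 \<Longrightarrow> twisted_boundary N x0 n \<rho> p (Poly_Mapping.single (\<sigma>, j) a) =
    chain_smult a (generator_boundary N x0 n \<rho> p \<sigma> j)"
  by (subst twisted_boundary_superset[of "{(\<sigma>, j)}"]) auto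

section \<open>Boundaries, homology classes and the operations of the homology module\<close>

definition twisted_boundaries ::
    "'a::topological_space set \<Rightarrow> 'a \<Rightarrow> nat \<Rightarrow> ((real \<Rightarrow> 'a) set \<Rightarrow> laurent mat) \<Rightarrow> nat \<Rightarrow> 'a twisted_chain set" where
  "twisted_boundaries N x0 n \<rho> p = twisted_boundary N x0 n \<rho> (Suc p) ` twisted_chains N n (Suc p)"

context
  fixes N :: "'a::topological_space set" and x0 :: 'a and n :: nat
    and \<rho> :: "(real \<Rightarrow> 'a) set \<Rightarrow> laurent mat" and p :: nat
begin

abbreviation "Bd \<equiv> twisted_boundaries N x0 n \<rho> p"

lemma twisted_boundaries_add: "b \<in> Bd \<Longrightarrow> c \<in> Bd \<Longrightarrow> b + c \<in> Bd"
  unfolding twisted_boundaries_def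
  by (auto simp flip: twisted_boundary_add intro!: imageI twisted_chains_add)

lemma twisted_boundaries_smult: "b \<in> Bd \<Longrightarrow> chain_smult a b \<in> Bd"
  unfolding twisted_boundaries_def
  by (auto simp flip: twisted_boundary_smult intro!: imageI twisted_chains_smult)

lemma twisted_boundaries_zero: "0 \<in> Bd"
proof -
  have "twisted_boundary N x0 n \<rho> (Suc p) 0 = 0" by (simp add: twisted_boundary_def)
  then show ?thesis
    unfolding twisted_boundaries_def by (metis imageI twisted_chains_zero)
qed

lemma twisted_boundaries_uminus: "b \<in> Bd \<Longrightarrow> - b \<in> Bd"
  using twisted_boundaries_smult[of b "- 1"] by (simp add: chain_smult_minus_one)

lemma twisted_boundaries_diff: "b \<in> Bd \<Longrightarrow> c \<in> Bd \<Longrightarrow> b - c \<in> Bd"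
  using twisted_boundaries_add[of b "- c"] twisted_boundaries_uminus[of c] by simp

text \<open>Cosets are formed for all chains, so equations between classes can be handled without
  cycle conditions; cycles enter only through the carrier.\<close>

definition homology_class :: "'a twisted_chain \<Rightarrow> 'a twisted_chain set" where
  "homology_class c = (\<lambda>b. b + c) ` twisted_boundaries N x0 n \<rho> p"

lemma mem_homology_class: "d \<in> homology_class c \<longleftrightarrow> d - c \<in> Bd"
proof
  assume "d - c \<in> Bd"
  then show "d \<in> homology_class c"
    unfolding homology_class_def by (rule rev_image_eqI) simp
qed (auto simp: homology_class_def)

lemma homology_class_eq_iff: "homology_class c = homology_class d \<longleftrightarrow> c - d \<in> Bd"
proof
  assume "homology_class c = homology_class d"
  moreover have "c \<in> homology_class c" by (simp add: mem_homology_class twisted_boundaries_zero)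
  ultimately show "c - d \<in> Bd" by (simp add: mem_homology_class)
next
  assume cd: "c - d \<in> Bd"
  have "b - c \<in> Bd \<longleftrightarrow> b - d \<in> Bd" for b
    using twisted_boundaries_add[of "b - c" "c - d"] twisted_boundaries_diff[of "b - d" "c - d"] cd by auto
  then show "homology_class c = homology_class d" by (auto simp: mem_homology_class)
qed

abbreviation "Hom \<equiv> twisted_homology N x0 n \<rho> p"

lemma twisted_cycle_coset: "Bd +>\<^bsub>twisted_cycle_module N x0 n \<rho> p\<^esub> c = homology_class c"
  by (auto simp: a_r_coset_def' homology_class_def twisted_cycle_module_def)

lemma carrier_twisted_homology:
  "carrier Hom = homology_class ` {c \<in> twisted_chains N n p. twisted_boundary N x0 n \<rho> p c = 0}"
  unfolding twisted_homology_def quotient_module_def twisted_boundaries_def[symmetric]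
  by (auto simp: A_RCOSETS_def' twisted_cycle_coset) (auto simp: twisted_cycle_module_def)

lemma add_twisted_homology: "homology_class c \<oplus>\<^bsub>Hom\<^esub> homology_class d = homology_class (c + d)"
proof -
  have "homology_class c \<oplus>\<^bsub>Hom\<^esub> homology_class d = {u + v | u v. u \<in> homology_class c \<and> v \<in> homology_class d}"
    unfolding twisted_homology_def quotient_module_def
    by (auto simp: set_add_def') (auto simp: twisted_cycle_module_def)
  also have "\<dots> = homology_class (c + d)"
  proof (intro subset_antisym subsetI)
    fix y assume "y \<in> {u + v | u v. u \<in> homology_class c \<and> v \<in> homology_class d}"
    then obtain u v where "y - (c + d) = (u - c) + (v - d)" "u - c \<in> Bd" "v - d \<in> Bd"
      by (auto simp: mem_homology_class algebra_simps)
    then show "y \<in> homology_class (c + d)" by (simp only: mem_homology_class twisted_boundaries_add)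
  next
    fix y assume "y \<in> homology_class (c + d)"
    then have "y = (y - d) + d" "y - d \<in> homology_class c" "d \<in> homology_class d"
      by (simp_all add: mem_homology_class twisted_boundaries_zero algebra_simps)
    then show "y \<in> {u + v | u v. u \<in> homology_class c \<and> v \<in> homology_class d}" by blast
  qed
  finally show ?thesis .
qed

lemma smult_twisted_homology: "a \<odot>\<^bsub>Hom\<^esub> homology_class c = homology_class (chain_smult a c)"
proof -
  have "a \<odot>\<^bsub>Hom\<^esub> homology_class c = (\<Union>d\<in>homology_class c. homology_class (chain_smult a d))"
    unfolding twisted_homology_def quotient_module_def twisted_boundaries_def[symmetric]
    by (simp add: twisted_cycle_coset) (simp add: twisted_cycle_module_def)
  also have "homology_class (chain_smult a d) = homology_class (chain_smult a c)" if "d \<in> homology_class c" for d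
    using that twisted_boundaries_smult[of "d - c" a]
    by (simp add: homology_class_eq_iff mem_homology_class chain_smult_diff_right)
  then have "(\<Union>d\<in>homology_class c. homology_class (chain_smult a d)) = (\<Union>d\<in>homology_class c. homology_class (chain_smult a c))"
    by (rule SUP_cong[OF refl])
  also have "\<dots> = homology_class (chain_smult a c)"
    using twisted_boundaries_zero by (auto simp: homology_class_def)
  finally show ?thesis .
qed

lemma add_closed_twisted_homology:
  "x \<in> carrier Hom \<Longrightarrow> y \<in> carrier Hom \<Longrightarrow> x \<oplus>\<^bsub>Hom\<^esub> y \<in> carrier Hom"
  by (auto simp: carrier_twisted_homology add_twisted_homology twisted_chains_add twisted_boundary_add)

lemma smult_closed_twisted_homology: "x \<in> carrier Hom \<Longrightarrow> a \<odot>\<^bsub>Hom\<^esub> x \<in> carrier Hom"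
  by (auto simp: carrier_twisted_homology smult_twisted_homology twisted_chains_smult twisted_boundary_smult)

end

section \<open>The semilinear symmetry of the twisted chain complex\<close>

text \<open>\<open>t \<mapsto> w t\<close> on coefficients, together with conjugation by \<open>diag(1, w\<^sup>-\<^sup>1, w\<^sup>-\<^sup>2, \<dots>)\<close>.\<close>

definition chain_rescale :: "complex \<Rightarrow> 'a twisted_chain \<Rightarrow> 'a twisted_chain" where
  "chain_rescale w c = Poly_Mapping.mapp (\<lambda>x a. Poly_Mapping.single 0 (inverse w ^ snd x) * rescale w a) c"

lemma lookup_chain_rescale [simp]:
  "Poly_Mapping.lookup (chain_rescale w c) x =
    Poly_Mapping.single 0 (inverse w ^ snd x) * rescale w (Poly_Mapping.lookup c x)"
  by (auto simp: chain_rescale_def lookup_mapp when_def in_keys_iff)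

lemma chain_rescale_add: "chain_rescale w (c + d) = chain_rescale w c + chain_rescale w d"
  by (rule poly_mapping_eqI) (simp add: lookup_add algebra_simps)

lemma chain_rescale_zero [simp]: "chain_rescale w 0 = 0"
  by (rule poly_mapping_eqI) simp

lemma chain_rescale_diff: "chain_rescale w (c - d) = chain_rescale w c - chain_rescale w d"
  by (rule poly_mapping_eqI) (simp add: lookup_minus algebra_simps)

lemma chain_rescale_sum: "chain_rescale w (\<Sum>x\<in>A. f x) = (\<Sum>x\<in>A. chain_rescale w (f x))"
  by (induction A rule: infinite_finite_induct) (simp_all add: chain_rescale_add)

lemma chain_rescale_smult:
  "w \<noteq> 0 \<Longrightarrow> chain_rescale w (chain_smult a c) = chain_smult (rescale w a) (chain_rescale w c)"
  by (rule poly_mapping_eqI) (simp add: algebra_simps)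

lemma chain_rescale_single:
  "chain_rescale w (Poly_Mapping.single x a) =
    Poly_Mapping.single x (Poly_Mapping.single 0 (inverse w ^ snd x) * rescale w a)"
  by (rule poly_mapping_eqI) (auto simp: lookup_single when_def)

lemma chain_rescale_inverse:
  fixes c :: "'a twisted_chain"
  assumes "w \<noteq> 0"
  shows "chain_rescale w (chain_rescale (inverse w) c) = c"
proof (rule poly_mapping_eqI)
  fix x :: "((nat \<Rightarrow> real) \<Rightarrow> 'a) \<times> nat"
  have "Poly_Mapping.single (0::int) (inverse w ^ snd x) * Poly_Mapping.single 0 (w ^ snd x) = 1"
    using assms by (simp add: mult_single flip: power_mult_distrib)
  then show "Poly_Mapping.lookup (chain_rescale w (chain_rescale (inverse w) c)) x = Poly_Mapping.lookup c x"
    using assms by (simp add: mult.assoc[symmetric])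
qed

lemma chain_rescale_in_twisted_chains:
  assumes "w \<noteq> 0"
  shows "chain_rescale w c \<in> twisted_chains N n p \<longleftrightarrow> c \<in> twisted_chains N n p"
proof -
  have "Poly_Mapping.single (0::int) (inverse w ^ snd x) \<noteq> 0" for x :: "((nat \<Rightarrow> real) \<Rightarrow> 'a) \<times> nat"
    using assms by (auto simp: poly_mapping_eq_iff fun_eq_iff lookup_single intro!: exI[of _ 0])
  moreover have "rescale w a = 0 \<longleftrightarrow> a = 0" for a
    using keys_rescale[OF assms, of a] by (metis keys_eq_empty)
  ultimately have "Poly_Mapping.keys (chain_rescale w c) = Poly_Mapping.keys c"
    by (auto simp: in_keys_iff)
  then show ?thesis by (simp add: twisted_chains_def)
qed

text \<open>The hypothesis says that t -> w t multiplies the entry (i, j) of every matrix by w^(i -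
  j). This matches the difference of the weights attached to e_i and e_j, so the 0-th face is
  respected; the other faces keep the index j and carry only signs.\<close>

lemma chain_rescale_twisted_boundary:
  assumes w: "w \<noteq> 0"
    and \<rho>: "\<And>g i j. i < n \<Longrightarrow> j < n \<Longrightarrow>
      Poly_Mapping.single 0 (inverse w ^ i) * rescale w (\<rho> g $$ (i, j)) = Poly_Mapping.single 0 (inverse w ^ j) * \<rho> g $$ (i, j)"
    and c: "c \<in> twisted_chains N n p"
  shows "chain_rescale w (twisted_boundary N x0 n \<rho> p c) = twisted_boundary N x0 n \<rho> p (chain_rescale w c)"
proof (cases "p = 0")
  case True
  then show ?thesis by (simp add: twisted_boundary_def)
next
  case False
  \<comment> \<open>A generator is an eigenvector rather than fixed: the factor w^(-j) is the one
    that \<open>chain_rescale\<close> attaches to \<sigma> \<otimes> e_j itself.\<close>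
  have gen: "chain_rescale w (generator_boundary N x0 n \<rho> p \<sigma> j) =
      chain_smult (Poly_Mapping.single 0 (inverse w ^ j)) (generator_boundary N x0 n \<rho> p \<sigma> j)" if "j < n" for \<sigma> j
  proof -
    have "rescale w ((- 1) ^ k) = (- 1) ^ k" for k
      using w by (induction k) simp_all
    then show ?thesis
      using \<rho> that
      by (simp add: generator_boundary_def chain_rescale_add chain_rescale_sum chain_rescale_single
          chain_smult_add_right chain_smult_sum)
  qed
  let ?K = "Poly_Mapping.keys c"
  have "chain_rescale w (twisted_boundary N x0 n \<rho> p c) =
      (\<Sum>x\<in>?K. chain_smult (rescale w (Poly_Mapping.lookup c x))
        (chain_rescale w (generator_boundary N x0 n \<rho> p (fst x) (snd x))))"
    using False w by (simp add: twisted_boundary_def chain_rescale_sum chain_rescale_smult)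
  also have "\<dots> = (\<Sum>x\<in>?K. chain_smult (Poly_Mapping.lookup (chain_rescale w c) x)
      (generator_boundary N x0 n \<rho> p (fst x) (snd x)))"
    using c by (intro sum.cong) (auto simp: twisted_chains_def gen chain_smult_assoc mult.commute)
  also have "\<dots> = twisted_boundary N x0 n \<rho> p (chain_rescale w c)"
    using False by (subst twisted_boundary_superset[of ?K]) (auto simp: in_keys_iff)
  finally show ?thesis .
qed

text \<open>Rescaling preserves and reflects cycles and boundaries, hence permutes the homology
  classes semilinearly. The argument is uniform in the degree p.\<close>

lemma order_twisted_homology_poly_in_t_power:
  assumes n: "n \<ge> 1" and w: "\<And>k::int. w powi k = 1 \<longleftrightarrow> int n dvd k"
    and \<rho>: "\<And>g i j. i < n \<Longrightarrow> j < n \<Longrightarrow>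
      Poly_Mapping.single 0 (inverse w ^ i) * rescale w (\<rho> g $$ (i, j)) = Poly_Mapping.single 0 (inverse w ^ j) * \<rho> g $$ (i, j)"
    and \<Delta>: "is_order_of \<Delta> (twisted_homology N x0 n \<rho> p)"
  shows "\<exists>q. equal_up_to_unit \<Delta> (poly_in_t_power n q)"
proof (rule poly_in_t_power_if_rescale_invariant[OF n w])
  let ?H = "twisted_homology N x0 n \<rho> p" and ?d = "twisted_boundary N x0 n \<rho>"
  let ?B = "twisted_boundaries N x0 n \<rho> p" and ?cl = "homology_class N x0 n \<rho> p"
  let ?Z = "{c \<in> twisted_chains N n p. ?d p c = 0}"
  let ?f = "chain_rescale w" and ?g = "chain_rescale (inverse w)"
  have w0: "w \<noteq> 0"
  proof
    assume "w = 0"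
    moreover have "w powi int n = 1" by (simp only: w dvd_refl)
    ultimately show False using n by (simp add: power_0_left)
  qed
  have comm: "?f (?d r c) = ?d r (?f c)" if "c \<in> twisted_chains N n r" for r c
    using chain_rescale_twisted_boundary[OF w0, where \<rho> = \<rho>] \<rho> that by blast
  have fg: "?f (?g c) = c" and gf: "?g (?f c) = c" for c :: "'a twisted_chain"
    using chain_rescale_inverse[of w c] chain_rescale_inverse[of "inverse w" c] w0 by simp_all
  have f_ch: "?f c \<in> twisted_chains N n r \<longleftrightarrow> c \<in> twisted_chains N n r"
    and g_ch: "?g c \<in> twisted_chains N n r \<longleftrightarrow> c \<in> twisted_chains N n r" for c r
    using w0 by (simp_all add: chain_rescale_in_twisted_chains)
  have B: "?f b \<in> ?B \<longleftrightarrow> b \<in> ?B" for b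
  proof
    assume "?f b \<in> ?B"
    then obtain c where c: "c \<in> twisted_chains N n (Suc p)" "?f b = ?d (Suc p) c"
      by (auto simp: twisted_boundaries_def)
    \<comment> \<open>Commutation with the boundary is known for w; inserting c =
      \<open>?f (?g c)\<close> moves the inverse past the boundary too.\<close>
    have "b = ?g (?d (Suc p) (?f (?g c)))" using c(2) by (metis fg gf)
    also have "\<dots> = ?d (Suc p) (?g c)" using c(1) by (simp add: comm[symmetric] g_ch gf)
    finally show "b \<in> ?B" using c(1) by (auto simp: twisted_boundaries_def g_ch)
  qed (auto simp: twisted_boundaries_def comm f_ch intro!: imageI)
  have Z: "?f c \<in> ?Z \<longleftrightarrow> c \<in> ?Z" for c
  proof -
    have "?f (?d p c) = 0 \<longleftrightarrow> ?d p c = 0" by (metis chain_rescale_zero gf)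
    then show ?thesis using comm[of c p] by (auto simp: f_ch)
  qed
  have cl: "?f ` ?cl c = ?cl (?f c)" for c
  proof (intro subset_antisym subsetI)
    fix d assume "d \<in> ?f ` ?cl c"
    then show "d \<in> ?cl (?f c)"
      by (auto simp: mem_homology_class B simp flip: chain_rescale_diff)
  next
    fix d assume "d \<in> ?cl (?f c)"
    then have "?f (?g d - c) \<in> ?B" by (simp add: mem_homology_class chain_rescale_diff fg)
    then have "?g d \<in> ?cl c" by (simp add: B mem_homology_class)
    then show "d \<in> ?f ` ?cl c" by (metis fg imageI)
  qed
  show "equal_up_to_unit (rescale w \<Delta>) \<Delta>"
  proof (rule order_rescale_if_semilinear[where \<psi> = "image ?f"])
    show "bij_betw (image ?f) (carrier ?H) (carrier ?H)"
      unfolding bij_betw_def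
    proof
      show "inj_on (image ?f) (carrier ?H)"
        by (rule inj_onI) (metis (no_types, lifting) gf image_image image_ident image_cong)
      have "?f ` ?Z = ?Z"
        using Z fg by (metis (no_types, lifting) image_eqI subsetI subset_antisym image_subsetI)
      then show "image ?f ` carrier ?H = carrier ?H"
        unfolding carrier_twisted_homology image_image cl by (metis image_image)
    qed
    show "?f ` (x \<oplus>\<^bsub>?H\<^esub> y) = ?f ` x \<oplus>\<^bsub>?H\<^esub> ?f ` y" if "x \<in> carrier ?H" "y \<in> carrier ?H" for x y
      using that unfolding carrier_twisted_homology
      by (elim imageE) (simp add: add_twisted_homology cl chain_rescale_add)
    show "?f ` (a \<odot>\<^bsub>?H\<^esub> x) = rescale w a \<odot>\<^bsub>?H\<^esub> ?f ` x" if "x \<in> carrier ?H" for a x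
      using that w0 unfolding carrier_twisted_homology
      by (elim imageE) (simp add: smult_twisted_homology cl chain_rescale_smult)
  qed (use w0 \<Delta> in \<open>simp_all add: add_closed_twisted_homology smult_closed_twisted_homology\<close>)
qed

section \<open>Path connectedness of the knot exterior\<close>

text \<open>The coordinate sphere is traded for the unit sphere of \<complex> \<times> \<complex>, a
  real space of dimension 4, where connectedness of spheres is available.\<close>

lemma path_connected_space_nsphere_3: "path_connected_space (nsphere 3)"
proof -
  have card: "card (Basis :: (complex \<times> complex) set) = 4"
    by simp
  obtain f :: "(nat \<Rightarrow> real) \<Rightarrow> complex \<times> complex" and g
    where "homeomorphic_maps (nsphere (4 - 1)) (top_of_set (sphere 0 1 \<inter> span Basis)) f g"
    by (rule homeomorphic_maps_nsphere_euclidean_sphere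
        [of "Basis :: (complex \<times> complex) set" 4, OF independent_Basis orthogonal_Basis card])
      (simp_all add: norm_Basis)
  moreover have "nsphere (4 - 1) = nsphere 3" by simp
  ultimately have "nsphere 3 homeomorphic_space top_of_set (sphere (0 :: complex \<times> complex) 1)"
    unfolding homeomorphic_space_def span_Basis Int_UNIV_right by metis
  moreover have "path_connected (sphere (0 :: complex \<times> complex) 1)"
    by (simp add: path_connected_sphere)
  ultimately show ?thesis
    by (simp add: homeomorphic_path_connected_space)
qed

text \<open>Homology in degree 0 detects path connectedness.\<close>

lemma path_connected_integral_homology_3_sphere:
  "integral_homology_3_sphere S \<Longrightarrow> path_connected S"
  using isomorphic_homology_imp_path_connectedness[of "top_of_set S" "nsphere 3"] path_connected_space_nsphere_3
  unfolding integral_homology_3_sphere_def by auto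

context
  fixes S :: "'a::t2_space set" and K :: "real \<Rightarrow> 'a" and \<phi> :: "complex \<times> complex \<Rightarrow> 'a"
  assumes tube: "tubular_parametrization S K \<phi>"
begin

lemma tube_facts:
  shows tube_open: "openin (top_of_set S) (\<phi> ` (sphere 0 1 \<times> ball 0 1))"
    and tube_continuous: "continuous_on (sphere 0 1 \<times> UNIV) \<phi>"
    and tube_inj: "inj_on \<phi> (sphere 0 1 \<times> UNIV)"
    and tube_subset: "\<phi> ` (sphere 0 1 \<times> UNIV) \<subseteq> S"
proof -
  let ?W = "\<phi> ` (sphere 0 1 \<times> UNIV)"
  obtain \<psi> where hom: "homeomorphism (sphere 0 1 \<times> UNIV) ?W \<phi> \<psi>"
    and W: "openin (top_of_set S) ?W"
    using tube unfolding tubular_parametrization_def by blast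
  show "continuous_on (sphere 0 1 \<times> UNIV) \<phi>" using hom by (simp add: homeomorphism_def)
  show "inj_on \<phi> (sphere 0 1 \<times> UNIV)" using homeomorphism_apply1[OF hom] by (rule inj_on_inverseI)
  show "?W \<subseteq> S" using W by (simp add: openin_imp_subset)
  have "openin (top_of_set (sphere 0 1 \<times> UNIV)) ((sphere 0 1 \<times> UNIV) \<inter> (UNIV \<times> ball (0::complex) 1 :: (complex \<times> complex) set))"
    by (intro openin_open_Int open_Times) auto
  also have "(sphere 0 1 \<times> UNIV) \<inter> (UNIV \<times> ball (0::complex) 1) = (sphere 0 1 \<times> ball (0::complex) 1 :: (complex \<times> complex) set)"
    by auto
  finally have "openin (top_of_set ?W) (\<phi> ` (sphere 0 1 \<times> ball 0 1))"
    by (rule homeomorphism_imp_open_map[OF hom])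
  then show "openin (top_of_set S) (\<phi> ` (sphere 0 1 \<times> ball 0 1))"
    using W by (rule openin_trans)
qed

lemma boundary_torus_subset: "\<phi> ` (sphere 0 1 \<times> sphere 0 1) \<subseteq> knot_exterior S \<phi>"
proof
  fix y assume "y \<in> \<phi> ` (sphere 0 1 \<times> sphere 0 1)"
  then obtain u v where y: "y = \<phi> (u, v)" and uv: "norm u = 1" "norm v = 1" by auto
  have "y \<in> S" using tube_subset uv by (auto simp: y)
  moreover have "y \<notin> \<phi> ` (sphere 0 1 \<times> ball 0 1)"
  proof
    assume "y \<in> \<phi> ` (sphere 0 1 \<times> ball 0 1)"
    then obtain u' v' where "y = \<phi> (u', v')" "norm u' = 1" "norm v' < 1" by auto
    then have "(u, v) = (u', v')" using uv by (intro inj_onD[OF tube_inj]) (auto simp: y)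
    with uv \<open>norm v' < 1\<close> show False by simp
  qed
  ultimately show "y \<in> knot_exterior S \<phi>" by (simp add: knot_exterior_def)
qed

text \<open>Every point of the exterior is joined to the boundary torus by the initial segment, up to the
  first visit of the closed tube, of a path in the ambient space.\<close>

lemma path_connected_knot_exterior:
  assumes S: "path_connected S"
  shows "path_connected (knot_exterior S \<phi>)"
proof -
  let ?N = "knot_exterior S \<phi>"
  let ?O = "\<phi> ` (sphere 0 1 \<times> ball 0 1)" and ?T = "\<phi> ` (sphere 0 1 \<times> cball 0 1)"
    and ?B = "\<phi> ` (sphere 0 1 \<times> sphere 0 1)"
  define b where "b = \<phi> (1, 1)"
  have b: "b \<in> ?B" by (auto simp: b_def)
  have pcB: "path_connected ?B"
  proof (rule path_connected_continuous_image)
    show "continuous_on (sphere 0 1 \<times> sphere 0 1) \<phi>"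
      by (rule continuous_on_subset[OF tube_continuous]) auto
    show "path_connected (sphere (0::complex) 1 \<times> sphere (0::complex) 1)"
      by (intro path_connected_Times) (simp_all add: path_connected_sphere)
  qed
  have "compact ?T"
    by (intro compact_continuous_image compact_Times continuous_on_subset[OF tube_continuous]) auto
  then have T: "closed ?T" by (rule compact_imp_closed)
  have TB: "y \<in> ?B" if "y \<in> ?T" "y \<notin> ?O" for y
  proof -
    from that(1) obtain u v where "y = \<phi> (u, v)" "u \<in> sphere 0 1" "v \<in> cball 0 1" by blast
    moreover from this that(2) have "v \<notin> ball 0 1" by blast
    ultimately show ?thesis by (intro image_eqI[of _ _ "(u, v)"]) auto
  qed
  have OT: "?O \<subseteq> ?T" by auto
  have "path_component ?N x b" if x: "x \<in> ?N" for x
  proof -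
    have "b \<in> S" using b boundary_torus_subset by (auto simp: knot_exterior_def)
    then obtain g where g: "path g" "path_image g \<subseteq> S" "pathstart g = x" "pathfinish g = b"
      using S x unfolding path_connected_def knot_exterior_def by (meson DiffD1)
    have cg: "continuous_on {0..1} g" using g(1) by (simp add: path_def)
    let ?A = "{0..1} \<inter> g -` ?T"
    have "closed ?A"
      using continuous_closed_preimage[OF cg _ T] by simp
    moreover have "bounded ?A"
      by (rule bounded_subset[OF compact_imp_bounded[OF compact_Icc]]) auto
    ultimately have "compact ?A"
      by (simp only: compact_eq_bounded_closed)
    moreover have "1 \<in> ?A" using g(4) b by (auto simp: pathfinish_def)
    ultimately obtain t where t: "t \<in> ?A" and t_min: "\<And>s. s \<in> ?A \<Longrightarrow> t \<le> s"
      using compact_attains_inf[of ?A] by blast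
    have before: "g s \<in> ?N" if "0 \<le> s" "s < t" for s
    proof -
      have "s \<in> {0..1}" using that t by auto
      then have "g s \<notin> ?T" "g s \<in> S" using t_min[of s] that g(2) by (auto simp: path_image_def)
      then show ?thesis using OT by (auto simp: knot_exterior_def)
    qed
    \<comment> \<open>If the first visit t to the closed tube were in the open tube, then nearby
      earlier times would lie in the tube as well, against minimality. The case t = 0 is excluded
      because the path starts in the exterior.\<close>
    have "g t \<notin> ?O"
    proof
      assume gt: "g t \<in> ?O"
      have "t \<noteq> 0" using gt x g(3) by (auto simp: knot_exterior_def pathstart_def)
      with t have t0: "t > 0" "t \<le> 1" by auto
      have "openin (top_of_set {0..1}) ({0..1} \<inter> g -` ?O)"
        by (rule continuous_openin_preimage[OF cg _ tube_open]) (use g(2) in \<open>auto simp: path_image_def\<close>)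
      moreover have "t \<in> {0..1} \<inter> g -` ?O" using gt t by blast
      ultimately have "\<exists>e>0. \<forall>s\<in>{0..1}. dist s t < e \<longrightarrow> s \<in> {0..1} \<inter> g -` ?O"
        unfolding openin_euclidean_subtopology_iff by blast
      then obtain e where e: "e > 0" "\<And>s. s \<in> {0..1} \<Longrightarrow> dist s t < e \<Longrightarrow> g s \<in> ?O"
        by blast
      define s where "s = max 0 (t - e / 2)"
      have "s \<in> {0..1}" "dist s t < e" "s < t" using t0 e(1) by (auto simp: s_def dist_real_def)
      then have "s \<in> ?A" using e(2)[of s] OT by auto
      with t_min[of s] \<open>s < t\<close> show False by simp
    qed
    with t TB[of "g t"] have gtB: "g t \<in> ?B" by simp
    have "path_component ?N x (g t)"
    proof -
      let ?h = "\<lambda>s. g (t * s)"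
      have rng: "t * s \<in> {0..t}" if "s \<in> {0..1}" for s
        using that t by (auto simp: mult_left_le)
      have "?h s \<in> ?N" if "s \<in> {0..1}" for s
      proof (cases "t * s = t")
        case True
        then show ?thesis using gtB boundary_torus_subset by (simp only: subsetD)
      next
        case False
        then have "0 \<le> t * s" "t * s < t" using rng[OF that] unfolding atLeastAtMost_iff by linarith+
        then show ?thesis by (rule before)
      qed
      then have "path_image ?h \<subseteq> ?N" by (auto simp: path_image_def)
      moreover have "path ?h"
        unfolding path_def
        by (rule continuous_on_compose2[OF cg]) (use rng t in \<open>force intro!: continuous_intros\<close>)+
      ultimately show ?thesis
        unfolding path_component_def using g(3)
        by (intro exI[of _ ?h]) (auto simp: pathstart_def pathfinish_def)
    qed
    moreover have "path_component ?N (g t) b"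
      using pcB gtB b boundary_torus_subset by (meson path_component_of_subset path_connected_component)
    ultimately show ?thesis by (rule path_component_trans)
  qed
  then show ?thesis
    unfolding path_connected_component by (meson path_component_sym path_component_trans)
qed

end

section \<open>The fundamental group\<close>

definition loop_at :: "'a::topological_space set \<Rightarrow> 'a \<Rightarrow> (real \<Rightarrow> 'a) \<Rightarrow> bool" where
  "loop_at N x0 p \<longleftrightarrow> path p \<and> path_image p \<subseteq> N \<and> pathstart p = x0 \<and> pathfinish p = x0"

lemma path_class_eqI: "homotopic_paths N p q \<Longrightarrow> path_class N p = path_class N q"
  unfolding path_class_def using homotopic_paths_sym homotopic_paths_trans by blast

text \<open>The library states the next three facts for normed spaces only, where the constant path is
  a line segment.\<close>

lemma homotopic_paths_join_const:
  fixes p :: "real \<Rightarrow> 'a::topological_space"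
  assumes "path p" "path_image p \<subseteq> N"
  shows "homotopic_paths N (p +++ (\<lambda>_. pathfinish p)) p"
proof (rule homotopic_paths_sym, rule homotopic_paths_reparametrize[where f = "\<lambda>t. min (2 * t) 1"])
  show "continuous_on {0..1} (\<lambda>t::real. min (2 * t) 1)" by (intro continuous_intros)
qed (use assms in \<open>auto simp: joinpaths_def pathfinish_def min_def\<close>)

lemma homotopic_paths_const_join:
  fixes p :: "real \<Rightarrow> 'a::topological_space"
  assumes "path p" "path_image p \<subseteq> N"
  shows "homotopic_paths N ((\<lambda>_. pathstart p) +++ p) p"
proof (rule homotopic_paths_sym, rule homotopic_paths_reparametrize[where f = "\<lambda>t. max (2 * t - 1) 0"])
  show "continuous_on {0..1} (\<lambda>t::real. max (2 * t - 1) 0)" by (intro continuous_intros)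
qed (use assms in \<open>auto simp: joinpaths_def pathstart_def max_def\<close>)

lemma homotopic_paths_join_reverse:
  fixes p :: "real \<Rightarrow> 'a::topological_space"
  assumes p: "path p" "path_image p \<subseteq> N"
  shows "homotopic_paths N (p +++ reversepath p) (\<lambda>_. pathstart p)"
  unfolding homotopic_paths
\<comment> \<open>The tent function 1 - |2t - 1| describes p followed by its reverse; at stage s of
  the homotopy the path turns back already at parameter 1 - s.\<close>
proof (intro exI[of _ "\<lambda>x. p ((1 - fst x) * (1 - \<bar>2 * snd x - 1\<bar>))"] conjI ballI)
  have rng: "(1 - s) * (1 - \<bar>2 * t - 1\<bar>) \<in> {0..1}" if "s \<in> {0..1}" "t \<in> {0..1}" for s t :: real
  proof -
    have "\<bar>2 * t - 1\<bar> \<le> 1" using that by auto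
    then show ?thesis using that by (auto intro!: mult_nonneg_nonneg mult_le_one)
  qed
  show "continuous_on ({0..1} \<times> {0..1}) (\<lambda>x. p ((1 - fst x) * (1 - \<bar>2 * snd x - 1\<bar>)))"
  proof (rule continuous_on_compose2[of "{0..1}" p])
    show "continuous_on {0..1} p" using p by (simp add: path_def)
    show "continuous_on ({0..1} \<times> {0..1}) (\<lambda>x::real \<times> real. (1 - fst x) * (1 - \<bar>2 * snd x - 1\<bar>))"
      by (intro continuous_intros)
  qed (use rng in auto)
  show "(\<lambda>x. p ((1 - fst x) * (1 - \<bar>2 * snd x - 1\<bar>))) \<in> {0..1} \<times> {0..1} \<rightarrow> N"
    using rng p(2) by (auto simp: path_image_def)
qed (auto simp: joinpaths_def reversepath_def pathstart_def pathfinish_def abs_if algebra_simps)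

lemma homotopic_paths_reverse_join:
  fixes p :: "real \<Rightarrow> 'a::topological_space"
  assumes "path p" "path_image p \<subseteq> N"
  shows "homotopic_paths N (reversepath p +++ p) (\<lambda>_. pathfinish p)"
  using homotopic_paths_join_reverse[of "reversepath p" N] assms by simp

context
  fixes N :: "'a::topological_space set" and x0 :: 'a
  assumes x0: "x0 \<in> N"
begin

lemma loop_at_const: "loop_at N x0 (\<lambda>_. x0)"
  using x0 by (auto simp: loop_at_def path_def path_image_def pathstart_def pathfinish_def)

lemma loop_at_join: "loop_at N x0 p \<Longrightarrow> loop_at N x0 q \<Longrightarrow> loop_at N x0 (p +++ q)"
  by (auto simp: loop_at_def path_image_join)

lemma loop_at_reversepath: "loop_at N x0 p \<Longrightarrow> loop_at N x0 (reversepath p)"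
  by (auto simp: loop_at_def)

lemma carrier_fundamental_group: "carrier (fundamental_group N x0) = path_class N ` Collect (loop_at N x0)"
  by (auto simp: fundamental_group_def loop_at_def)

lemma one_fundamental_group: "\<one>\<^bsub>fundamental_group N x0\<^esub> = path_class N (\<lambda>_. x0)"
  by (simp add: fundamental_group_def)

lemma mult_fundamental_group:
  assumes p: "loop_at N x0 p" and q: "loop_at N x0 q"
  shows "path_class N p \<otimes>\<^bsub>fundamental_group N x0\<^esub> path_class N q = path_class N (p +++ q)"
proof -
  have "path_class N (p' +++ q') = path_class N (p +++ q)"
    if "p' \<in> path_class N p" "q' \<in> path_class N q" for p' q'
    using that p q
    by (intro path_class_eqI homotopic_paths_sym[OF homotopic_paths_join])
      (auto simp: path_class_def loop_at_def)
  moreover have "p \<in> path_class N p" "q \<in> path_class N q"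
    using p q by (auto simp: path_class_def loop_at_def)
  ultimately have "(\<Union>p'\<in>path_class N p. \<Union>q'\<in>path_class N q. path_class N (p' +++ q')) = path_class N (p +++ q)"
    by blast
  then show ?thesis by (simp add: fundamental_group_def)
qed

lemma group_fundamental_group: "group (fundamental_group N x0)"
proof (rule groupI)
  let ?G = "fundamental_group N x0"
  show "x \<otimes>\<^bsub>?G\<^esub> y \<in> carrier ?G" if "x \<in> carrier ?G" "y \<in> carrier ?G" for x y
    using that by (auto simp: carrier_fundamental_group mult_fundamental_group loop_at_join)
  show "\<one>\<^bsub>?G\<^esub> \<in> carrier ?G"
    by (auto simp: carrier_fundamental_group one_fundamental_group loop_at_const)
  show "x \<otimes>\<^bsub>?G\<^esub> y \<otimes>\<^bsub>?G\<^esub> z = x \<otimes>\<^bsub>?G\<^esub> (y \<otimes>\<^bsub>?G\<^esub> z)"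
    if xyz: "x \<in> carrier ?G" "y \<in> carrier ?G" "z \<in> carrier ?G" for x y z
  proof -
    obtain p q r where p: "x = path_class N p" "y = path_class N q" "z = path_class N r"
        "loop_at N x0 p" "loop_at N x0 q" "loop_at N x0 r"
      using xyz by (auto simp: carrier_fundamental_group)
    then have "path_class N (p +++ (q +++ r)) = path_class N ((p +++ q) +++ r)"
      by (intro path_class_eqI homotopic_paths_assoc) (auto simp: loop_at_def)
    with p show ?thesis by (simp add: mult_fundamental_group loop_at_join)
  qed
  show "\<one>\<^bsub>?G\<^esub> \<otimes>\<^bsub>?G\<^esub> x = x" if x: "x \<in> carrier ?G" for x
  proof -
    obtain p where p: "x = path_class N p" "loop_at N x0 p"
      using x by (auto simp: carrier_fundamental_group)
    then have "path_class N ((\<lambda>_. x0) +++ p) = path_class N p"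
      using homotopic_paths_const_join[of p N] by (intro path_class_eqI) (auto simp: loop_at_def)
    with p show ?thesis by (simp add: mult_fundamental_group loop_at_const one_fundamental_group)
  qed
  show "\<exists>y\<in>carrier ?G. y \<otimes>\<^bsub>?G\<^esub> x = \<one>\<^bsub>?G\<^esub>" if x: "x \<in> carrier ?G" for x
  proof -
    obtain p where p: "x = path_class N p" "loop_at N x0 p"
      using x by (auto simp: carrier_fundamental_group)
    then have "path_class N (reversepath p +++ p) = path_class N (\<lambda>_. x0)"
      using homotopic_paths_reverse_join[of p N] by (intro path_class_eqI) (auto simp: loop_at_def)
    with p have "path_class N (reversepath p) \<otimes>\<^bsub>?G\<^esub> x = \<one>\<^bsub>?G\<^esub>"
      by (simp add: mult_fundamental_group loop_at_reversepath one_fundamental_group)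
    moreover have "path_class N (reversepath p) \<in> carrier ?G"
      using p by (simp add: carrier_fundamental_group loop_at_reversepath)
    ultimately show ?thesis by blast
  qed
qed

text \<open>Shows that an edge whose reverse runs along c^-1, p and b acquires the class of p once
  the basing paths c and b are attached at its ends. The end point of c is free.\<close>

lemma conjugated_loop_cancel:
  assumes p: "loop_at N x0 p" and c: "path c" "path_image c \<subseteq> N" "pathstart c = x0"
    and b: "loop_at N x0 b"
  shows "homotopic_paths N (c +++ ((reversepath c +++ (p +++ b)) +++ reversepath b)) p"
proof -
  let ?c = "reversepath c" and ?b = "reversepath b"
  have pp: "path p" "path_image p \<subseteq> N" "pathstart p = x0" "pathfinish p = x0"
    and bb: "path b" "path_image b \<subseteq> N" "pathstart b = x0" "pathfinish b = x0"
    using p b by (auto simp: loop_at_def)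
  have "homotopic_paths N ((p +++ b) +++ ?b) (p +++ (b +++ ?b))"
    using pp bb by (intro homotopic_paths_sym[OF homotopic_paths_assoc]) auto
  also have "homotopic_paths N (p +++ (b +++ ?b)) (p +++ (\<lambda>_. pathfinish p))"
    using pp bb homotopic_paths_join_reverse[of b N] by (intro homotopic_paths_join) auto
  also have "homotopic_paths N (p +++ (\<lambda>_. pathfinish p)) p"
    using pp by (intro homotopic_paths_join_const)
  finally have 1: "homotopic_paths N ((p +++ b) +++ ?b) p" .
  have "homotopic_paths N ((?c +++ (p +++ b)) +++ ?b) (?c +++ ((p +++ b) +++ ?b))"
    using pp bb c by (intro homotopic_paths_sym[OF homotopic_paths_assoc]) (auto simp: path_image_join)
  also have "homotopic_paths N (?c +++ ((p +++ b) +++ ?b)) (?c +++ p)"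
    by (rule homotopic_paths_join[OF _ 1]) (use c pp bb in \<open>auto simp: path_image_join\<close>)
  finally have 2: "homotopic_paths N ((?c +++ (p +++ b)) +++ ?b) (?c +++ p)" .
  have "homotopic_paths N (c +++ ((?c +++ (p +++ b)) +++ ?b)) (c +++ (?c +++ p))"
    by (rule homotopic_paths_join[OF _ 2]) (use c pp bb in \<open>auto simp: path_image_join\<close>)
  also have "homotopic_paths N (c +++ (?c +++ p)) ((c +++ ?c) +++ p)"
    using c pp by (intro homotopic_paths_assoc) auto
  also have "homotopic_paths N ((c +++ ?c) +++ p) ((\<lambda>_. pathstart p) +++ p)"
    using c pp homotopic_paths_join_reverse[of c N] by (intro homotopic_paths_join) auto
  also have "homotopic_paths N ((\<lambda>_. pathstart p) +++ p) p"
    using pp by (intro homotopic_paths_const_join)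
  finally show ?thesis .
qed

section \<open>Simplices of low dimension and transport\<close>

text \<open>The restriction is there because singular simplices are extensional functions on the
  standard simplex.\<close>

definition point_simplex :: "'b \<Rightarrow> (nat \<Rightarrow> real) \<Rightarrow> 'b" where
  "point_simplex y = restrict (\<lambda>_. y) (standard_simplex 0)"

lemma singular_simplex_point_simplex:
  "y \<in> N \<Longrightarrow> singular_simplex 0 (top_of_set N) (point_simplex y)"
  by (simp add: singular_simplex_def point_simplex_def)

lemma singular_simplex_0_cases:
  assumes "singular_simplex 0 (top_of_set N) \<sigma>"
  obtains y where "y \<in> N" "\<sigma> = point_simplex y"
proof
  let ?e = "\<lambda>j::nat. if j = 0 then 1 else 0 :: real"
  show "\<sigma> ?e \<in> N"
    using assms by (auto simp: singular_simplex_def continuous_map_def standard_simplex_0)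
  show "\<sigma> = point_simplex (\<sigma> ?e)"
    using assms by (auto simp: singular_simplex_def extensional_def point_simplex_def standard_simplex_0)
qed

lemma edge_point_in_standard_simplex:
  "s \<in> {0..1} \<Longrightarrow> (\<lambda>i. if i = 0 then 1 - s else if i = 1 then s else 0) \<in> standard_simplex 1"
  by (auto simp: standard_simplex_def)

lemma first_edge_path:
  assumes "singular_simplex 1 (top_of_set N) \<sigma>"
  shows "path (first_edge \<sigma>)" "path_image (first_edge \<sigma>) \<subseteq> N"
proof -
  let ?e = "\<lambda>s i::nat. if i = 0 then 1 - s else if i = 1 then s else (0::real)"
  have \<sigma>: "continuous_map (subtopology (powertop_real UNIV) (standard_simplex 1)) (top_of_set N) \<sigma>"
    using assms by (simp add: singular_simplex_def)
  have "continuous_map (top_of_set {0..1}) (powertop_real UNIV) ?e"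
    unfolding continuous_map_componentwise_UNIV
  proof
    fix k :: nat
    show "continuous_map (top_of_set {0..1}) euclideanreal (\<lambda>s. ?e s k)"
      unfolding continuous_map_iff_continuous
      by (cases "k = 0"; cases "k = 1") (simp_all add: continuous_intros)
  qed
  then have "continuous_map (top_of_set {0..1}) (subtopology (powertop_real UNIV) (standard_simplex 1)) ?e"
    using edge_point_in_standard_simplex unfolding continuous_map_in_subtopology by auto
  from continuous_map_compose[OF this \<sigma>]
  have "continuous_map (top_of_set {0..1}) (top_of_set N) (first_edge \<sigma>)"
    by (simp add: o_def first_edge_def[abs_def])
  then show "path (first_edge \<sigma>)" "path_image (first_edge \<sigma>) \<subseteq> N"
    by (auto simp: continuous_map_in_subtopology path_def path_image_def)
qed

text \<open>Face k omits vertex k, so face 0 is the terminal vertex of the edge. This fixes the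
  direction in which transport acts.\<close>

lemma singular_face_edge:
  "singular_face 1 0 \<sigma> = point_simplex (first_edge \<sigma> 1)"
  "singular_face 1 1 \<sigma> = point_simplex (first_edge \<sigma> 0)"
  by (auto simp: singular_face_def point_simplex_def first_edge_def simplical_face_def standard_simplex_0
      fun_eq_iff restrict_def intro!: arg_cong[of _ _ \<sigma>])

text \<open>The coordinate \<open>f 1\<close> identifies the standard 1-simplex with the unit
  interval, so a path composed with it is a singular simplex.\<close>

lemma exists_simplex_with_edge:
  assumes "path \<delta>" "path_image \<delta> \<subseteq> N"
  obtains \<sigma> where "singular_simplex 1 (top_of_set N) \<sigma>" "\<And>s. s \<in> {0..1} \<Longrightarrow> first_edge \<sigma> s = \<delta> s"
proof
  let ?\<sigma> = "restrict (\<delta> \<circ> (\<lambda>f. f 1)) (standard_simplex 1)"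
  have "continuous_map (subtopology (powertop_real UNIV) (standard_simplex 1)) euclideanreal (\<lambda>f. f 1)"
    by (metis (mono_tags) UNIV_I continuous_map_from_subtopology continuous_map_product_projection)
  then have "continuous_map (subtopology (powertop_real UNIV) (standard_simplex 1)) (top_of_set {0..1}) (\<lambda>f. f 1)"
    by (auto simp: continuous_map_in_subtopology standard_simplex_def)
  moreover have "continuous_map (top_of_set {0..1}) (top_of_set N) \<delta>"
    using assms by (auto simp: continuous_map_in_subtopology path_def path_image_def)
  ultimately show "singular_simplex 1 (top_of_set N) ?\<sigma>"
    by (simp add: singular_simplex_def continuous_map_compose)
  show "first_edge ?\<sigma> s = \<delta> s" if "s \<in> {0..1}" for s
    using edge_point_in_standard_simplex[OF that] by (simp add: first_edge_def)
qed

context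
  assumes conn: "path_connected N"
begin

lemma basing_path:
  assumes "y \<in> N"
  shows "path (basing_path N x0 y)" "path_image (basing_path N x0 y) \<subseteq> N"
    "pathstart (basing_path N x0 y) = x0" "pathfinish (basing_path N x0 y) = y"
proof -
  have "\<exists>p. path p \<and> path_image p \<subseteq> N \<and> pathstart p = x0 \<and> pathfinish p = y"
    using conn x0 assms unfolding path_connected_def by blast
  from someI_ex[OF this] show "path (basing_path N x0 y)" "path_image (basing_path N x0 y) \<subseteq> N"
    "pathstart (basing_path N x0 y) = x0" "pathfinish (basing_path N x0 y) = y"
    unfolding basing_path_def by blast+
qed

lemma transport_class_in_carrier:
  assumes "singular_simplex 1 (top_of_set N) \<sigma>"
  shows "transport_class N x0 \<sigma> \<in> carrier (fundamental_group N x0)"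
proof -
  note e = first_edge_path[OF assms]
  have "first_edge \<sigma> 0 \<in> N" "first_edge \<sigma> 1 \<in> N"
    using e(2) by (auto simp: path_image_def)
  note b0 = basing_path[OF this(1)] and b1 = basing_path[OF this(2)]
  show ?thesis
    unfolding carrier_fundamental_group transport_class_def
    using e b0 b1
    by (intro imageI) (auto simp: loop_at_def path_image_join pathstart_def pathfinish_def
        simp flip: pathstart_def pathfinish_def)
qed

text \<open>Source of all relations in degree zero: with y free, one edge can move the vertex and
  apply any group element at once.\<close>

lemma exists_simplex_with_transport_class:
  assumes y: "y \<in> N" and g: "g \<in> carrier (fundamental_group N x0)"
  obtains \<sigma> where "singular_simplex 1 (top_of_set N) \<sigma>" "singular_face 1 0 \<sigma> = point_simplex y"
    "singular_face 1 1 \<sigma> = point_simplex x0" "transport_class N x0 \<sigma> = g"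
proof -
  obtain p where p: "loop_at N x0 p" and g: "g = path_class N p"
    using g by (auto simp: carrier_fundamental_group)
  let ?c = "basing_path N x0 y" and ?b = "basing_path N x0 x0"
  note c = basing_path[OF y] and b = basing_path[OF x0]
  \<comment> \<open>The chosen path at \<open>x0\<close> is some loop, possibly not the constant
    one; the factor \<open>?b\<close> compensates for it.\<close>
  let ?d = "reversepath ?c +++ (p +++ ?b)"
  have d: "path ?d" "path_image ?d \<subseteq> N" "pathstart ?d = y" "pathfinish ?d = x0"
    using c b p by (auto simp: loop_at_def path_image_join)
  then have "path (reversepath ?d)" "path_image (reversepath ?d) \<subseteq> N" by simp_all
  then obtain \<sigma> where \<sigma>: "singular_simplex 1 (top_of_set N) \<sigma>"
    and e: "\<And>s. s \<in> {0..1} \<Longrightarrow> first_edge \<sigma> s = reversepath ?d s"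
    using exists_simplex_with_edge[of "reversepath ?d"] by metis
  have e01: "first_edge \<sigma> 0 = x0" "first_edge \<sigma> 1 = y"
    using e[of 0] e[of 1] d(3,4) by (simp_all add: reversepath_def pathstart_def pathfinish_def)
  have "homotopic_paths N ?d (reversepath (first_edge \<sigma>))"
    using d e by (intro homotopic_paths_eq) (auto simp: reversepath_def)
  then have "homotopic_paths N (?c +++ (?d +++ reversepath ?b)) (?c +++ (reversepath (first_edge \<sigma>) +++ reversepath ?b))"
    using c b d by (intro homotopic_paths_join) auto
  moreover have "homotopic_paths N (?c +++ (?d +++ reversepath ?b)) p"
    using p c b by (intro conjugated_loop_cancel) (auto simp: loop_at_def)
  ultimately have "homotopic_paths N (?c +++ (reversepath (first_edge \<sigma>) +++ reversepath ?b)) p"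
    using homotopic_paths_sym homotopic_paths_trans by blast
  then have "transport_class N x0 \<sigma> = g"
    unfolding transport_class_def e01 g by (rule path_class_eqI)
  with \<sigma> show ?thesis
    by (intro that[of \<sigma>]) (simp_all add: singular_face_edge[simplified] e01)
qed

end

end

lemma meridian_in_fundamental_group:
  assumes tube: "tubular_parametrization S K \<phi>" and m: "is_meridian (knot_exterior S \<phi>) \<phi> x0 m"
  shows "m \<in> carrier (fundamental_group (knot_exterior S \<phi>) x0)"
proof -
  let ?N = "knot_exterior S \<phi>"
  obtain u \<beta> where u: "u \<in> sphere 0 1" and \<beta>: "path \<beta>" "path_image \<beta> \<subseteq> ?N" "pathstart \<beta> = x0" "pathfinish \<beta> = \<phi> (u, 1)"
    and m: "m = path_class ?N (\<beta> +++ ((\<lambda>s. \<phi> (u, cis (2 * pi * s))) +++ reversepath \<beta>))"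
    using m unfolding is_meridian_def by blast
  let ?l = "\<lambda>s. \<phi> (u, cis (2 * pi * s))"
  have "path ?l"
    unfolding path_def
    by (rule continuous_on_compose2[OF tube_continuous[OF tube]]) (use u in \<open>auto intro!: continuous_intros\<close>)
  moreover have "path_image ?l \<subseteq> ?N"
    using u boundary_torus_subset[OF tube] by (auto simp: path_image_def)
  moreover have "pathstart ?l = \<phi> (u, 1)" "pathfinish ?l = \<phi> (u, 1)"
    by (simp_all add: pathstart_def pathfinish_def)
  ultimately show ?thesis
    unfolding m fundamental_group_def using \<beta>
    by (auto simp: path_image_join intro!: exI[of _ "\<beta> +++ (?l +++ reversepath \<beta>)"])
qed

section \<open>Powers of the cyclic matrix\<close>

text \<open>Closed form of P_z^k for every integer k, negative ones included: e_c goes to z^k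
  e_(c+k), with the index read modulo n.\<close>

definition cyclic_matrix_power :: "nat \<Rightarrow> complex \<Rightarrow> int \<Rightarrow> complex mat" where
  "cyclic_matrix_power n z k =
     Matrix.mat n n (\<lambda>(r, c). if int n dvd int r - int c - k then z powi k else 0)"

lemma cyclic_matrix_power_carrier [simp]: "cyclic_matrix_power n z k \<in> carrier_mat n n"
  by (simp add: cyclic_matrix_power_def)

lemma cyclic_matrix_power_index:
  "r < n \<Longrightarrow> c < n \<Longrightarrow>
    cyclic_matrix_power n z k $$ (r, c) = (if int n dvd int r - int c - k then z powi k else 0)"
  by (simp add: cyclic_matrix_power_def)

lemma dvd_int_diff_iff_eq_mod:
  assumes "n \<ge> 1" "i < n"
  shows "int n dvd int i - k \<longleftrightarrow> i = nat (k mod int n)"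
proof -
  have "int n dvd int i - k \<longleftrightarrow> int i mod int n = k mod int n"
    by (rule mod_eq_dvd_iff[symmetric])
  also have "int i mod int n = int i" using assms by simp
  also have "int i = k mod int n \<longleftrightarrow> i = nat (k mod int n)"
    using assms by auto
  finally show ?thesis .
qed

lemma cyclic_matrix_power_0: "cyclic_matrix_power n z 0 = 1\<^sub>m n"
proof (rule eq_matI)
  fix i j assume ij: "i < dim_row (1\<^sub>m n :: complex mat)" "j < dim_col (1\<^sub>m n :: complex mat)"
  then have "int n dvd int i - int j \<longleftrightarrow> i = j"
    using dvd_int_diff_iff_eq_mod[of n i "int j"] by auto
  then show "cyclic_matrix_power n z 0 $$ (i, j) = 1\<^sub>m n $$ (i, j)"
    using ij by (simp add: cyclic_matrix_power_index)
qed (simp_all add: cyclic_matrix_power_def)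

lemma cyclic_matrix_power_1: "cyclic_matrix_power n z 1 = cyclic_matrix n z"
proof (rule eq_matI)
  fix i j assume ij: "i < dim_row (cyclic_matrix n z)" "j < dim_col (cyclic_matrix n z)"
  then have "int n dvd int i - int (Suc j) \<longleftrightarrow> i = Suc j mod n"
    using dvd_int_diff_iff_eq_mod[of n i "int (Suc j)"]
    by (simp add: cyclic_matrix_def flip: of_nat_mod of_nat_Suc)
  then show "cyclic_matrix_power n z 1 $$ (i, j) = cyclic_matrix n z $$ (i, j)"
    using ij by (simp add: cyclic_matrix_power_index cyclic_matrix_def algebra_simps)
qed (simp_all add: cyclic_matrix_power_def cyclic_matrix_def)

lemma cyclic_matrix_power_add:
  assumes "n \<ge> 1" "z \<noteq> 0"
  shows "cyclic_matrix_power n z k * cyclic_matrix_power n z l = cyclic_matrix_power n z (k + l)"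
proof (rule eq_matI)
  fix r c assume "r < dim_row (cyclic_matrix_power n z (k + l))" "c < dim_col (cyclic_matrix_power n z (k + l))"
  then have rc: "r < n" "c < n" by (simp_all add: cyclic_matrix_power_def)
  \<comment> \<open>This is the one row in which column c of the right factor is nonzero, so the
    matrix product reduces to a single term.\<close>
  define m where "m = nat ((int c + l) mod int n)"
  have m: "m < n" using assms(1) by (simp add: m_def nat_less_iff)
  have "int n dvd int m - (int c + l)"
    using dvd_int_diff_iff_eq_mod[OF assms(1) m] by (simp add: m_def)
  then have dvd: "int n dvd int r - int c - (k + l) \<longleftrightarrow> int n dvd int r - int m - k"
    using dvd_add_left_iff[of "int n" "int m - (int c + l)" "int r - int m - k"]
    by (simp add: algebra_simps)
  have "(cyclic_matrix_power n z k * cyclic_matrix_power n z l) $$ (r, c) =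
      (\<Sum>i<n. cyclic_matrix_power n z k $$ (r, i) * cyclic_matrix_power n z l $$ (i, c))"
    using rc by (simp add: cyclic_matrix_power_def scalar_prod_def lessThan_atLeast0)
  also have "\<dots> = (\<Sum>i<n. if i = m then cyclic_matrix_power n z k $$ (r, m) * z powi l else 0)"
  proof (rule sum.cong)
    fix i assume "i \<in> {..<n}"
    then have i: "i < n" by simp
    have "int n dvd int i - int c - l \<longleftrightarrow> i = m"
      using dvd_int_diff_iff_eq_mod[OF assms(1) i, of "int c + l"] by (simp add: m_def algebra_simps)
    then show "cyclic_matrix_power n z k $$ (r, i) * cyclic_matrix_power n z l $$ (i, c) =
        (if i = m then cyclic_matrix_power n z k $$ (r, m) * z powi l else 0)"
      using i rc by (simp add: cyclic_matrix_power_index)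
  qed simp
  also have "\<dots> = cyclic_matrix_power n z k $$ (r, m) * z powi l" using m by simp
  also have "\<dots> = cyclic_matrix_power n z (k + l) $$ (r, c)"
    using rc m dvd assms(2) by (simp add: cyclic_matrix_power_index power_int_add)
  finally show "(cyclic_matrix_power n z k * cyclic_matrix_power n z l) $$ (r, c) =
      cyclic_matrix_power n z (k + l) $$ (r, c)" .
qed (simp_all add: cyclic_matrix_power_def)

lemma group_GL: "group (GL n)"
  by (rule monoid.units_group) (rule ring.is_monoid, rule ring_mat)

text \<open>The closed form is a homomorphism from \<int> to GL(n), with the form at -k as inverse;
  such a homomorphism consists of the powers of its value at 1.\<close>

lemma cyclic_matrix_int_pow:
  assumes "n \<ge> 1" "z \<noteq> 0"
  shows "cyclic_matrix n z [^]\<^bsub>GL n\<^esub> (k :: int) = cyclic_matrix_power n z k"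
proof -
  let ?Q = "cyclic_matrix_power n z"
  have "?Q k \<in> carrier (GL n)" for k
    unfolding units_of_carrier Units_def
    using cyclic_matrix_power_add[OF assms, of k "- k"] cyclic_matrix_power_add[OF assms, of "- k" k]
    by (auto simp: ring_mat_def cyclic_matrix_power_0 intro!: exI[of _ "?Q (- k)"])
  then have "?Q \<in> hom integer_group (GL n)"
    by (simp add: hom_def integer_group_def units_of_def ring_mat_def cyclic_matrix_power_add[OF assms])
  then interpret group_hom integer_group "GL n" ?Q
    by (intro group_hom.intro group_hom_axioms.intro group_GL) simp_all
  have "?Q (1 [^]\<^bsub>integer_group\<^esub> k) = ?Q 1 [^]\<^bsub>GL n\<^esub> k"
    by (rule hom_int_pow) (simp add: integer_group_def)
  then show ?thesis by (simp add: cyclic_matrix_power_1)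
qed

section \<open>Values of the metabelian representation\<close>

context
  fixes G :: "('g, 'b) monoid_scheme" and m :: 'g and \<epsilon> :: "'g \<Rightarrow> int"
    and chi :: "'g set \<Rightarrow> complex"
  assumes G: "group G" and m: "m \<in> carrier G" and \<epsilon>: "is_abelianization_to_int G m \<epsilon>"
    and chi: "chi \<in> hom (alexander_group G) complex_units"
begin

interpretation group G by (rule G)

lemma \<epsilon>_hom: "group_hom G integer_group \<epsilon>"
  using \<epsilon> by (intro group_hom.intro group_hom_axioms.intro G)
    (auto simp: is_abelianization_to_int_def epi_def)

interpretation \<epsilon>: group_hom G integer_group \<epsilon> by (rule \<epsilon>_hom)

lemma \<epsilon>_m: "\<epsilon> m = 1"
  and commutator_iff: "g \<in> commutator_subgroup G \<longleftrightarrow> g \<in> carrier G \<and> \<epsilon> g = 0"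
  using \<epsilon> unfolding is_abelianization_to_int_def kernel_def by auto

lemma second_commutator_normal: "second_commutator_subgroup G \<lhd> G"
  by (intro derived_is_normal derived_self_is_normal)

interpretation D2: normal "second_commutator_subgroup G" G by (rule second_commutator_normal)

lemma carrier_alexander_group:
  "carrier (alexander_group G) = (\<lambda>g. second_commutator_subgroup G #>\<^bsub>G\<^esub> g) ` commutator_subgroup G"
  by (auto simp: alexander_group_def carrier_FactGroup r_coset_def)

lemma second_commutator_in_alexander_group: "second_commutator_subgroup G \<in> carrier (alexander_group G)"
proof -
  have "\<one>\<^bsub>G\<^esub> \<in> commutator_subgroup G" by (simp add: subgroup.one_closed derived_is_subgroup)
  then show ?thesis
    unfolding carrier_alexander_group using D2.subset by (metis coset_mult_one imageI)
qed

text \<open>The identity of H is the coset \<pi>^(2) itself; its value under \<open>chi\<close> is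
  idempotent and nonzero.\<close>

lemma chi_one: "chi (second_commutator_subgroup G) = 1"
proof -
  let ?D = "second_commutator_subgroup G"
  have "?D \<otimes>\<^bsub>alexander_group G\<^esub> ?D = ?D"
    using subgroup_mult_id[OF D2.is_subgroup] by (simp add: alexander_group_def set_mult_def)
  then have "chi ?D = chi ?D * chi ?D"
    using chi second_commutator_in_alexander_group hom_mult[OF chi, of ?D ?D] by (simp add: complex_units_def)
  moreover have "chi ?D \<noteq> 0"
    using hom_in_carrier[OF chi second_commutator_in_alexander_group] by (simp add: complex_units_def)
  ultimately show ?thesis by simp
qed

text \<open>The action is an image taken elementwise, so it must be seen to give a full coset again:
  conjugation by a power of \<open>m\<close> maps the normal subgroup \<pi>^(2) onto itself.\<close>

lemma t_action_coset:
  assumes g: "g \<in> carrier G"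
  shows "t_action G m k (second_commutator_subgroup G #>\<^bsub>G\<^esub> g) =
    second_commutator_subgroup G #>\<^bsub>G\<^esub> (m [^]\<^bsub>G\<^esub> (- k) \<otimes>\<^bsub>G\<^esub> g \<otimes>\<^bsub>G\<^esub> m [^]\<^bsub>G\<^esub> k)"
proof -
  let ?D = "second_commutator_subgroup G"
  let ?a = "m [^]\<^bsub>G\<^esub> (- k)" and ?b = "m [^]\<^bsub>G\<^esub> k"
  have ab: "?a \<in> carrier G" "?b \<in> carrier G" using m by auto
  have b: "?b = inv\<^bsub>G\<^esub> ?a" using m by (simp add: int_pow_neg)
  have DG: "d \<in> carrier G" if "d \<in> ?D" for d using that D2.subset by blast
  have key: "?a \<otimes>\<^bsub>G\<^esub> (d \<otimes>\<^bsub>G\<^esub> g) \<otimes>\<^bsub>G\<^esub> ?b = (?a \<otimes>\<^bsub>G\<^esub> d \<otimes>\<^bsub>G\<^esub> ?b) \<otimes>\<^bsub>G\<^esub> (?a \<otimes>\<^bsub>G\<^esub> g \<otimes>\<^bsub>G\<^esub> ?b)"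
    if "d \<in> ?D" for d
  proof -
    have "?b \<otimes>\<^bsub>G\<^esub> (?a \<otimes>\<^bsub>G\<^esub> y) = y" if "y \<in> carrier G" for y
      using ab that by (simp add: b m_assoc[symmetric])
    then show ?thesis using ab g DG[OF that] by (simp add: m_assoc)
  qed
  have in1: "?a \<otimes>\<^bsub>G\<^esub> d \<otimes>\<^bsub>G\<^esub> ?b \<in> ?D" if "d \<in> ?D" for d
    unfolding b using that ab by (intro D2.inv_op_closed2)
  have in2: "\<exists>d'\<in>?D. d = ?a \<otimes>\<^bsub>G\<^esub> d' \<otimes>\<^bsub>G\<^esub> ?b" if d: "d \<in> ?D" for d
  proof
    show "?b \<otimes>\<^bsub>G\<^esub> d \<otimes>\<^bsub>G\<^esub> ?a \<in> ?D"
      using d ab D2.inv_op_closed1[of ?a d] by (simp add: b)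
    show "d = ?a \<otimes>\<^bsub>G\<^esub> (?b \<otimes>\<^bsub>G\<^esub> d \<otimes>\<^bsub>G\<^esub> ?a) \<otimes>\<^bsub>G\<^esub> ?b"
      using ab DG[OF d] by (simp add: b m_assoc) (simp add: m_assoc[symmetric])
  qed
  show ?thesis
  proof (intro subset_antisym subsetI)
    fix x assume "x \<in> t_action G m k (?D #>\<^bsub>G\<^esub> g)"
    then obtain d where "d \<in> ?D" "x = ?a \<otimes>\<^bsub>G\<^esub> (d \<otimes>\<^bsub>G\<^esub> g) \<otimes>\<^bsub>G\<^esub> ?b"
      by (auto simp: t_action_def r_coset_def)
    then show "x \<in> ?D #>\<^bsub>G\<^esub> (?a \<otimes>\<^bsub>G\<^esub> g \<otimes>\<^bsub>G\<^esub> ?b)"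
      using in1 key by (auto simp: r_coset_def)
  next
    fix x assume "x \<in> ?D #>\<^bsub>G\<^esub> (?a \<otimes>\<^bsub>G\<^esub> g \<otimes>\<^bsub>G\<^esub> ?b)"
    then obtain d where d: "d \<in> ?D" "x = d \<otimes>\<^bsub>G\<^esub> (?a \<otimes>\<^bsub>G\<^esub> g \<otimes>\<^bsub>G\<^esub> ?b)"
      by (auto simp: r_coset_def)
    from in2[OF d(1)] obtain d' where "d' \<in> ?D" "d = ?a \<otimes>\<^bsub>G\<^esub> d' \<otimes>\<^bsub>G\<^esub> ?b" by blast
    with d(2) key[of d'] have "d' \<in> ?D" "x = ?a \<otimes>\<^bsub>G\<^esub> (d' \<otimes>\<^bsub>G\<^esub> g) \<otimes>\<^bsub>G\<^esub> ?b" by simp_all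
    then show "x \<in> t_action G m k (?D #>\<^bsub>G\<^esub> g)"
      by (auto simp: t_action_def r_coset_def)
  qed
qed

lemma t_action_closed:
  assumes "h \<in> carrier (alexander_group G)"
  shows "t_action G m k h \<in> carrier (alexander_group G)"
proof -
  obtain g where g: "g \<in> commutator_subgroup G" "h = second_commutator_subgroup G #>\<^bsub>G\<^esub> g"
    using assms unfolding carrier_alexander_group by blast
  have "m [^]\<^bsub>G\<^esub> (- k) \<otimes>\<^bsub>G\<^esub> g \<otimes>\<^bsub>G\<^esub> m [^]\<^bsub>G\<^esub> k \<in> commutator_subgroup G"
    using g(1) m by (auto simp: commutator_iff \<epsilon>.hom_int_pow)
  then show ?thesis
    using g by (auto simp: carrier_alexander_group t_action_coset commutator_iff intro!: imageI)
qed

lemma t_action_0: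
  assumes "h \<in> carrier (alexander_group G)"
  shows "t_action G m 0 h = h"
proof -
  obtain g where g: "g \<in> commutator_subgroup G" "h = second_commutator_subgroup G #>\<^bsub>G\<^esub> g"
    using assms unfolding carrier_alexander_group by blast
  then show ?thesis by (simp add: t_action_coset commutator_iff)
qed

lemma t_action_one: "t_action G m k (second_commutator_subgroup G) = second_commutator_subgroup G"
proof -
  have "m [^]\<^bsub>G\<^esub> (- k) \<otimes>\<^bsub>G\<^esub> \<one>\<^bsub>G\<^esub> \<otimes>\<^bsub>G\<^esub> m [^]\<^bsub>G\<^esub> k = \<one>\<^bsub>G\<^esub>"
    using m by (simp add: int_pow_neg)
  then show ?thesis
    using t_action_coset[of "\<one>\<^bsub>G\<^esub>" k] D2.subset by (simp add: coset_mult_one)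
qed

context
  fixes n :: nat and z :: complex
  assumes n: "n \<ge> 1" and z: "z \<noteq> 0"
begin

lemma metabelian_rep_eq:
  "metabelian_rep G m \<epsilon> n chi z g = cyclic_matrix_power n z (\<epsilon> g) *
     mat_diag n (\<lambda>i. chi (t_action G m (int i)
       (second_commutator_subgroup G #>\<^bsub>G\<^esub> (m [^]\<^bsub>G\<^esub> (- \<epsilon> g) \<otimes>\<^bsub>G\<^esub> g))))"
  by (simp add: metabelian_rep_def semidirect_rep_def to_semidirect_def cyclic_matrix_int_pow[OF n z])

text \<open>The diagonal factor only scales columns, so the zero pattern is that of
  P_z^\<epsilon>(g), whatever the character. This pattern drives the symmetry in t.\<close>

lemma metabelian_rep_index:
  assumes "i < n" "j < n"
  shows "metabelian_rep G m \<epsilon> n chi z g $$ (i, j) =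
    (if int n dvd int i - int j - \<epsilon> g then z powi \<epsilon> g else 0) *
    chi (t_action G m (int j) (second_commutator_subgroup G #>\<^bsub>G\<^esub> (m [^]\<^bsub>G\<^esub> (- \<epsilon> g) \<otimes>\<^bsub>G\<^esub> g)))"
  unfolding metabelian_rep_eq
  using assms by (subst mat_diag_mult_right[of _ n]) (simp_all add: cyclic_matrix_power_index)

lemma metabelian_rep_dim: "metabelian_rep G m \<epsilon> n chi z g \<in> carrier_mat n n"
  unfolding metabelian_rep_eq by (rule mult_carrier_mat[of _ n n]) auto

lemma metabelian_rep_index_trivial:
  assumes "trivial_character G chi" "g \<in> carrier G" "i < n" "j < n"
  shows "metabelian_rep G m \<epsilon> n chi z g $$ (i, j) =
    (if int n dvd int i - int j - \<epsilon> g then z powi \<epsilon> g else 0)"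
proof -
  have "m [^]\<^bsub>G\<^esub> (- \<epsilon> g) \<otimes>\<^bsub>G\<^esub> g \<in> commutator_subgroup G"
    using m assms(2) by (simp add: commutator_iff \<epsilon>.hom_int_pow \<epsilon>_m)
  then have "second_commutator_subgroup G #>\<^bsub>G\<^esub> (m [^]\<^bsub>G\<^esub> (- \<epsilon> g) \<otimes>\<^bsub>G\<^esub> g) \<in> carrier (alexander_group G)"
    by (simp add: carrier_alexander_group)
  from t_action_closed[OF this] show ?thesis
    using assms unfolding trivial_character_def by (simp add: metabelian_rep_index)
qed

text \<open>The component in H of a power of the meridian is trivial, so the character drops
  out.\<close>

lemma metabelian_rep_index_power:
  assumes "i < n" "j < n"
  shows "metabelian_rep G m \<epsilon> n chi z (m [^]\<^bsub>G\<^esub> (k :: int)) $$ (i, j) =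
    (if int n dvd int i - int j - k then z powi k else 0)"
proof -
  have "\<epsilon> (m [^]\<^bsub>G\<^esub> k) = k"
    using m by (simp add: \<epsilon>.hom_int_pow \<epsilon>_m)
  moreover have "m [^]\<^bsub>G\<^esub> (- k) \<otimes>\<^bsub>G\<^esub> m [^]\<^bsub>G\<^esub> k = \<one>\<^bsub>G\<^esub>"
    using m by (simp add: int_pow_neg)
  ultimately show ?thesis
    using assms D2.subset by (simp add: metabelian_rep_index coset_mult_one t_action_one chi_one)
qed

text \<open>On commutators the cyclic factor is the identity. Column 0 suffices because e_0
  generates the zeroth homology, and there t^0 leaves the character value unshifted.\<close>

lemma metabelian_rep_index_commutator:
  assumes g: "g \<in> commutator_subgroup G" and i: "i < n"
  shows "metabelian_rep G m \<epsilon> n chi z g $$ (i, 0) =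
    (if i = 0 then chi (second_commutator_subgroup G #>\<^bsub>G\<^esub> g) else 0)"
proof -
  have "int n dvd int i \<longleftrightarrow> i = 0"
    using i by (auto dest: dvd_imp_le)
  moreover have "second_commutator_subgroup G #>\<^bsub>G\<^esub> g \<in> carrier (alexander_group G)"
    using g by (simp add: carrier_alexander_group)
  ultimately show ?thesis
    using g i n by (simp add: metabelian_rep_index commutator_iff t_action_0)
qed

end

end

section \<open>The zeroth twisted homology\<close>

text \<open>This is (z t)^k, the factor collected by k steps along the meridian.\<close>

definition scaled_monomial :: "complex \<Rightarrow> int \<Rightarrow> laurent" where
  "scaled_monomial z k = Poly_Mapping.single k (z powi k)"

lemma scaled_monomial_0 [simp]: "scaled_monomial z 0 = 1"
  by (simp add: scaled_monomial_def)

lemma scaled_monomial_mult: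
  "z \<noteq> 0 \<Longrightarrow> scaled_monomial z k * scaled_monomial z l = scaled_monomial z (k + l)"
  by (simp add: scaled_monomial_def mult_single power_int_add)

text \<open>With u = (z t)^a this is the geometric sum; a negative exponent reduces to a positive
  one by 1 - u^k = -u^k (1 - u^(-k)).\<close>

lemma dvd_one_minus_scaled_monomial:
  assumes z: "z \<noteq> 0"
  shows "1 - scaled_monomial z a dvd 1 - scaled_monomial z (a * k)"
proof -
  let ?v = "scaled_monomial z"
  have nat: "1 - ?v a dvd 1 - ?v (a * int m)" for m
  proof (induction m)
    case (Suc m)
    have "1 - ?v (a * int (Suc m)) = (1 - ?v (a * int m)) + ?v (a * int m) * (1 - ?v a)"
      using z by (simp add: scaled_monomial_mult algebra_simps)
    then show ?case using Suc.IH by (simp only: dvd_add dvd_mult dvd_refl)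
  qed simp
  show ?thesis
  proof (cases "k \<ge> 0")
    case True
    then show ?thesis using nat[of "nat k"] by simp
  next
    case False
    have "1 - ?v (a * k) = - ?v (a * k) * (1 - ?v (a * (- k)))"
      using z by (simp add: scaled_monomial_mult algebra_simps)
    then show ?thesis using nat[of "nat (- k)"] False by (simp add: dvd_mult)
  qed
qed

text \<open>The functional \<open>x \<otimes> e\<^sub>j \<mapsto> (z t)\<^sup>-\<^sup>j\<close> on 0-chains; for the trivial character it identifies the
  zeroth homology with \<open>\<complex>[t\<^sup>\<plusminus>\<^sup>1] / (1 - z\<^sup>n t\<^sup>n)\<close>.\<close>

definition chain_functional :: "complex \<Rightarrow> 'a twisted_chain \<Rightarrow> laurent" where
  "chain_functional z c =
    (\<Sum>x\<in>Poly_Mapping.keys c. Poly_Mapping.lookup c x * scaled_monomial z (- int (snd x)))"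

lemma chain_functional_superset:
  assumes "finite A" "Poly_Mapping.keys c \<subseteq> A"
  shows "chain_functional z c = (\<Sum>x\<in>A. Poly_Mapping.lookup c x * scaled_monomial z (- int (snd x)))"
  unfolding chain_functional_def using assms
  by (auto intro!: sum.mono_neutral_left simp: in_keys_iff)

lemma chain_functional_add: "chain_functional z (c + d) = chain_functional z c + chain_functional z d"
proof -
  let ?A = "Poly_Mapping.keys c \<union> Poly_Mapping.keys d"
  have "Poly_Mapping.keys (c + d) \<subseteq> ?A" by (rule keys_add)
  then show ?thesis
    by (simp add: chain_functional_superset[of ?A] lookup_add sum.distrib algebra_simps)
qed

lemma chain_functional_zero [simp]: "chain_functional z 0 = 0"
  by (simp add: chain_functional_def)

lemma chain_functional_sum: "chain_functional z (\<Sum>x\<in>A. f x) = (\<Sum>x\<in>A. chain_functional z (f x))"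
  by (induction A rule: infinite_finite_induct) (simp_all add: chain_functional_add)

lemma chain_functional_smult: "chain_functional z (chain_smult a c) = a * chain_functional z c"
proof -
  have "Poly_Mapping.keys (chain_smult a c) \<subseteq> Poly_Mapping.keys c"
    by (auto simp: in_keys_iff)
  then show ?thesis
    by (simp add: chain_functional_superset[of "Poly_Mapping.keys c"] sum_distrib_left mult.assoc)
qed

lemma chain_functional_single [simp]:
  "chain_functional z (Poly_Mapping.single (\<sigma>, j) a) = a * scaled_monomial z (- int j)"
  by (subst chain_functional_superset[of "{(\<sigma>, j)}"]) auto

lemma twisted_chain_induct [consumes 1, case_names zero add]:
  assumes c: "c \<in> twisted_chains N n p"
    and "P 0"
    and "\<And>\<sigma> j a d. singular_simplex p (top_of_set N) \<sigma> \<Longrightarrow> j < n \<Longrightarrow> d \<in> twisted_chains N n p \<Longrightarrow>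
      P d \<Longrightarrow> P (Poly_Mapping.single (\<sigma>, j) a + d)"
  shows "P c"
proof -
  let ?s = "\<lambda>x. Poly_Mapping.single x (Poly_Mapping.lookup c x)"
  have partial: "finite A \<Longrightarrow> A \<subseteq> Poly_Mapping.keys c \<Longrightarrow> (\<Sum>x\<in>A. ?s x) \<in> twisted_chains N n p \<and> P (\<Sum>x\<in>A. ?s x)" for A
  proof (induction A rule: finite_induct)
    case (insert x A)
    obtain \<sigma> j where x: "x = (\<sigma>, j)" by (cases x)
    have \<sigma>: "singular_simplex p (top_of_set N) \<sigma>" "j < n"
      using insert.prems c x by (auto simp: twisted_chains_def)
    have eq: "(\<Sum>y\<in>insert x A. ?s y) = Poly_Mapping.single (\<sigma>, j) (Poly_Mapping.lookup c x) + (\<Sum>y\<in>A. ?s y)"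
      using insert.hyps x by simp
    have IH: "(\<Sum>y\<in>A. ?s y) \<in> twisted_chains N n p" "P (\<Sum>y\<in>A. ?s y)"
      using insert.IH insert.prems by blast+
    show ?case
      unfolding eq
      using twisted_chains_add[OF twisted_chains_single[OF \<sigma>] IH(1)] assms(3)[OF \<sigma> IH] by blast
  qed (simp_all add: twisted_chains_zero assms(2))
  have "(\<Sum>x\<in>Poly_Mapping.keys c. ?s x) = c"
    by (rule poly_mapping_eqI) (auto simp: lookup_sum lookup_single when_def in_keys_iff)
  with partial[OF finite_keys subset_refl] show ?thesis by simp
qed

text \<open>The zeroth homology is made cyclic by two matrices: an element \<open>e\<close> acting
  as the identity moves vertices to the base point, and \<mu> links neighbouring basis
  vectors.\<close>

context
  fixes N :: "'a::topological_space set" and x0 :: 'a and n :: nat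
    and \<rho> :: "(real \<Rightarrow> 'a) set \<Rightarrow> laurent mat" and z :: complex
    and e \<mu> :: "(real \<Rightarrow> 'a) set"
  assumes x0: "x0 \<in> N" and conn: "path_connected N" and n: "n \<ge> 1" and z: "z \<noteq> 0"
    and e: "e \<in> carrier (fundamental_group N x0)"
    and \<rho>_e: "\<And>i j. i < n \<Longrightarrow> j < n \<Longrightarrow> \<rho> e $$ (i, j) = (if i = j then 1 else 0)"
    and \<mu>: "\<mu> \<in> carrier (fundamental_group N x0)"
    and \<rho>_\<mu>: "\<And>i j. i < n \<Longrightarrow> j < n \<Longrightarrow> \<rho> \<mu> $$ (i, j) = (if i = Suc j mod n then scaled_monomial z 1 else 0)"
begin

abbreviation "cl \<equiv> homology_class N x0 n \<rho> 0"
abbreviation "B0 \<equiv> twisted_boundaries N x0 n \<rho> 0"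
abbreviation "H0 \<equiv> twisted_homology N x0 n \<rho> 0"

text \<open>A 1-simplex from \<open>x0\<close> to \<open>y\<close> with transport \<open>g\<close> identifies \<open>y \<otimes> \<rho>(g) v\<close> with \<open>x0 \<otimes> v\<close>.\<close>

lemma cl_transport:
  assumes y: "y \<in> N" and g: "g \<in> carrier (fundamental_group N x0)" and j: "j < n"
  shows "cl (chain_smult a (\<Sum>i<n. Poly_Mapping.single (point_simplex y, i) (\<rho> g $$ (i, j)))) =
    cl (Poly_Mapping.single (point_simplex x0, j) a)"
proof -
  obtain \<sigma> where \<sigma>: "singular_simplex 1 (top_of_set N) \<sigma>" "singular_face 1 0 \<sigma> = point_simplex y"
      "singular_face 1 1 \<sigma> = point_simplex x0" "transport_class N x0 \<sigma> = g"
    using exists_simplex_with_transport_class[OF x0 conn y g] by metis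
  have "twisted_boundary N x0 n \<rho> 1 (Poly_Mapping.single (\<sigma>, j) a) =
      chain_smult a (\<Sum>i<n. Poly_Mapping.single (point_simplex y, i) (\<rho> g $$ (i, j)))
      - Poly_Mapping.single (point_simplex x0, j) a"
    using \<sigma> by (simp add: twisted_boundary_single generator_boundary_def chain_smult_diff_right single_uminus)
  moreover have "Poly_Mapping.single (\<sigma>, j) a \<in> twisted_chains N n 1"
    using \<sigma> j by (intro twisted_chains_single)
  ultimately show ?thesis
    unfolding homology_class_eq_iff twisted_boundaries_def
    by (intro image_eqI[of _ _ "Poly_Mapping.single (\<sigma>, j) a"]) simp_all
qed

lemma cl_move:
  assumes y: "y \<in> N" and j: "j < n"
  shows "cl (Poly_Mapping.single (point_simplex y, j) a) = cl (Poly_Mapping.single (point_simplex x0, j) a)"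
proof -
  have "(\<Sum>i<n. Poly_Mapping.single (point_simplex y, i) (\<rho> e $$ (i, j))) =
      (\<Sum>i<n. if i = j then Poly_Mapping.single (point_simplex y, j) 1 else 0)"
    using j by (intro sum.cong) (auto simp: \<rho>_e)
  then show ?thesis using cl_transport[OF y e j, of a] j by simp
qed

lemma cl_shift:
  assumes j: "j < n"
  shows "cl (Poly_Mapping.single (point_simplex x0, Suc j mod n) (a * scaled_monomial z 1)) =
    cl (Poly_Mapping.single (point_simplex x0, j) a)"
proof -
  have "(\<Sum>i<n. Poly_Mapping.single (point_simplex x0, i) (\<rho> \<mu> $$ (i, j))) =
      (\<Sum>i<n. if i = Suc j mod n then Poly_Mapping.single (point_simplex x0, Suc j mod n) (scaled_monomial z 1) else 0)"
    using j by (intro sum.cong) (auto simp: \<rho>_\<mu>)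
  also have "\<dots> = Poly_Mapping.single (point_simplex x0, Suc j mod n) (scaled_monomial z 1)"
    using n by simp
  finally show ?thesis using cl_transport[OF x0 \<mu> j, of a] by simp
qed

text \<open>Descending from e_j to e_0 divides by z t at each step. As j < n the index never wraps
  around; the relation from e_(n-1) to e_0 is kept in reserve for the order.\<close>

lemma cl_generator:
  "j < n \<Longrightarrow> cl (Poly_Mapping.single (point_simplex x0, j) a) =
    cl (Poly_Mapping.single (point_simplex x0, 0) (a * scaled_monomial z (- int j)))"
proof (induction j arbitrary: a)
  case (Suc j)
  have "cl (Poly_Mapping.single (point_simplex x0, Suc j) a) =
      cl (Poly_Mapping.single (point_simplex x0, Suc j mod n) (a * scaled_monomial z (- 1) * scaled_monomial z 1))"
    using Suc.prems z by (simp add: mult.assoc scaled_monomial_mult)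
  also have "\<dots> = cl (Poly_Mapping.single (point_simplex x0, j) (a * scaled_monomial z (- 1)))"
    using Suc.prems by (intro cl_shift) simp
  also have "\<dots> = cl (Poly_Mapping.single (point_simplex x0, 0) (a * scaled_monomial z (- 1) * scaled_monomial z (- int j)))"
    using Suc by simp
  finally show ?case using z by (simp add: mult.assoc scaled_monomial_mult)
qed simp

text \<open>Reduces every 0-chain to a multiple of e_0 over the base point; the functional is the
  resulting coefficient.\<close>

lemma cl_chain:
  "c \<in> twisted_chains N n 0 \<Longrightarrow> cl c = cl (Poly_Mapping.single (point_simplex x0, 0) (chain_functional z c))"
proof (induction c rule: twisted_chain_induct)
  case (add \<sigma> j a d)
  obtain y where y: "y \<in> N" "\<sigma> = point_simplex y"
    by (rule singular_simplex_0_cases[OF x0 add.hyps(1)])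
  have "cl (Poly_Mapping.single (\<sigma>, j) a + d) = cl (Poly_Mapping.single (\<sigma>, j) a) \<oplus>\<^bsub>H0\<^esub> cl d"
    by (simp add: add_twisted_homology)
  also have "cl (Poly_Mapping.single (\<sigma>, j) a) =
      cl (Poly_Mapping.single (point_simplex x0, 0) (a * scaled_monomial z (- int j)))"
    unfolding y(2) cl_move[OF y(1) add.hyps(2)] by (rule cl_generator[OF add.hyps(2)])
  also have "cl d = cl (Poly_Mapping.single (point_simplex x0, 0) (chain_functional z d))"
    by (rule add.IH)
  finally show ?case
    unfolding add_twisted_homology chain_functional_add chain_functional_single single_add .
qed simp

text \<open>Every 0-chain is a cycle, and all classes are multiples of one generator. What remains
  is the annihilator of that generator, which q describes.\<close>

lemma twisted_order_0_iff:
  assumes q: "\<And>a. Poly_Mapping.single (point_simplex x0, 0) a \<in> B0 \<longleftrightarrow> q dvd a"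
  shows "is_order_of p H0 \<longleftrightarrow> equal_up_to_unit p q"
proof (rule is_order_of_iff_if_cyclic[where g = "\<lambda>a. cl (Poly_Mapping.single (point_simplex x0, 0) a)"])
  have cyc: "carrier H0 = cl ` twisted_chains N n 0"
    by (simp add: carrier_twisted_homology twisted_boundary_def)
  have "Poly_Mapping.single (point_simplex x0, 0) a \<in> twisted_chains N n 0" for a
    using n by (intro twisted_chains_single singular_simplex_point_simplex[OF x0 x0]) auto
  then show "range (\<lambda>a. cl (Poly_Mapping.single (point_simplex x0, 0) a)) = carrier H0"
    unfolding cyc using cl_chain by blast
  show "cl (Poly_Mapping.single (point_simplex x0, 0) (a + b)) =
      cl (Poly_Mapping.single (point_simplex x0, 0) a) \<oplus>\<^bsub>H0\<^esub> cl (Poly_Mapping.single (point_simplex x0, 0) b)" for a b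
    by (simp add: add_twisted_homology single_add)
  show "cl (Poly_Mapping.single (point_simplex x0, 0) (a * b)) =
      a \<odot>\<^bsub>H0\<^esub> cl (Poly_Mapping.single (point_simplex x0, 0) b)" for a b
    by (simp add: smult_twisted_homology)
  show "cl (Poly_Mapping.single (point_simplex x0, 0) a) = cl (Poly_Mapping.single (point_simplex x0, 0) b)
      \<longleftrightarrow> q dvd a - b" for a b
    by (simp add: homology_class_eq_iff q flip: single_diff)
qed (simp_all add: add_closed_twisted_homology smult_closed_twisted_homology)

text \<open>Transport by g identifies e_0 with c e_0. The constant c - 1 is a unit, so e_0 itself is
  a boundary; a is a boundary by way of a/(c - 1).\<close>

lemma twisted_order_0_nontrivial:
  assumes g: "g \<in> carrier (fundamental_group N x0)" and c: "c \<noteq> 1"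
    and \<rho>_g: "\<And>i. i < n \<Longrightarrow> \<rho> g $$ (i, 0) = (if i = 0 then Poly_Mapping.single 0 c else 0)"
  shows "is_order_of p H0 \<longleftrightarrow> equal_up_to_unit p 1"
proof (rule twisted_order_0_iff)
  fix a :: laurent
  let ?s = "\<lambda>a. Poly_Mapping.single (point_simplex x0, 0::nat) (a :: laurent)"
  have "(\<Sum>i<n. Poly_Mapping.single (point_simplex x0, i) (\<rho> g $$ (i, 0))) =
      (\<Sum>i<n. if i = 0 then ?s (Poly_Mapping.single 0 c) else 0)"
    by (intro sum.cong) (auto simp: \<rho>_g)
  also have "\<dots> = ?s (Poly_Mapping.single 0 c)" using n by simp
  finally have "cl (?s (b * Poly_Mapping.single 0 c)) = cl (?s b)" for b
    using cl_transport[OF x0 g, of 0 b] n by simp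
  then have B: "?s (b * Poly_Mapping.single 0 c - b) \<in> B0" for b
    by (simp add: homology_class_eq_iff flip: single_diff)
  have "Poly_Mapping.single 0 (1 / (c - 1)) * (Poly_Mapping.single 0 c - 1) = (1 :: laurent)"
    using c by (simp add: mult_single flip: single_one single_diff)
  then have "a = (a * Poly_Mapping.single 0 (1 / (c - 1))) * Poly_Mapping.single 0 c - a * Poly_Mapping.single 0 (1 / (c - 1))"
    by (simp add: algebra_simps)
  then show "?s a \<in> B0 \<longleftrightarrow> 1 dvd a" using B by (metis one_dvd)
qed

text \<open>The functional sends boundaries into the ideal of 1 - (z t)^n, which bounds the
  annihilator from above; the wrap-around of the shift shows that the whole ideal is
  reached.\<close>

lemma twisted_order_0_trivial:
  assumes \<rho>: "\<And>g i j. g \<in> carrier (fundamental_group N x0) \<Longrightarrow> i < n \<Longrightarrow> j < n \<Longrightarrow>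
      \<rho> g $$ (i, j) = (if int n dvd int i - int j - \<epsilon> g then scaled_monomial z (\<epsilon> g) else 0)"
  shows "is_order_of p H0 \<longleftrightarrow> equal_up_to_unit p (1 - scaled_monomial z (int n))"
proof (rule twisted_order_0_iff)
  fix a :: laurent
  let ?q = "1 - scaled_monomial z (int n)"
  let ?s = "\<lambda>a. Poly_Mapping.single (point_simplex x0, 0::nat) (a :: laurent)"
  have gen: "?q dvd chain_functional z (generator_boundary N x0 n \<rho> 1 \<sigma> j)"
    if \<sigma>: "singular_simplex 1 (top_of_set N) \<sigma>" and j: "j < n" for \<sigma> j
  proof -
    let ?g = "transport_class N x0 \<sigma>"
    have g: "?g \<in> carrier (fundamental_group N x0)"
      by (rule transport_class_in_carrier[OF x0 conn \<sigma>])
    define i where "i = nat ((int j + \<epsilon> ?g) mod int n)"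
    have i: "i < n" using n by (simp add: i_def nat_less_iff)
    have i_iff: "int n dvd int r - int j - \<epsilon> ?g \<longleftrightarrow> r = i" if "r < n" for r
      using dvd_int_diff_iff_eq_mod[OF n that, of "int j + \<epsilon> ?g"] by (simp add: i_def algebra_simps)
    have "int n dvd int i - int j - \<epsilon> ?g" using i_iff[OF i] by simp
    \<comment> \<open>The integer k counts how often the index wraps around. The two ends of the
      edge contribute (z t)^(-j - n k) and (z t)^(-j), which agree modulo 1 - (z t)^n.\<close>
    then obtain k where k: "int i - int j - \<epsilon> ?g = int n * k" by (rule dvdE)
    have "(\<Sum>r<n. \<rho> ?g $$ (r, j) * scaled_monomial z (- int r)) =
        (\<Sum>r<n. if r = i then scaled_monomial z (\<epsilon> ?g) * scaled_monomial z (- int i) else 0)"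
      using j by (intro sum.cong) (auto simp: \<rho>[OF g] i_iff)
    also have "\<dots> = scaled_monomial z (- int j) * scaled_monomial z (int n * (- k))"
      using i z k by (simp add: scaled_monomial_mult algebra_simps)
    finally have "chain_functional z (generator_boundary N x0 n \<rho> 1 \<sigma> j) =
        - (scaled_monomial z (- int j) * (1 - scaled_monomial z (int n * (- k))))"
      by (simp add: generator_boundary_def chain_functional_add chain_functional_sum algebra_simps)
    then show ?thesis
      using dvd_one_minus_scaled_monomial[OF z, of "int n" "- k"] by (simp only: dvd_minus_iff dvd_mult)
  qed
  have bd: "?q dvd chain_functional z (twisted_boundary N x0 n \<rho> 1 c)" if "c \<in> twisted_chains N n 1" for c
    using that
    by (auto simp: twisted_boundary_def chain_functional_sum chain_functional_smult twisted_chains_def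
        intro!: dvd_sum dvd_mult gen[simplified])
  show "?s a \<in> B0 \<longleftrightarrow> ?q dvd a"
  proof
    assume "?s a \<in> B0"
    then obtain c where "c \<in> twisted_chains N n 1" "?s a = twisted_boundary N x0 n \<rho> 1 c"
      by (auto simp: twisted_boundaries_def)
    then have "?q dvd chain_functional z (?s a)" using bd by simp
    then show "?q dvd a" by simp
  next
    assume "?q dvd a"
    then obtain r where a: "a = ?q * r" by (rule dvdE)
    \<comment> \<open>The class of e_(n-1) is reduced to e_0 in two ways: one step up through the
      wrap-around, or n - 1 steps down. The results differ by (z t)^n, and the multiplier used next
      clears the negative power.\<close>
    have "cl (?s (b * scaled_monomial z 1)) = cl (?s (b * scaled_monomial z (1 - int n)))" for b
      using cl_shift[of "n - 1" b] cl_generator[of "n - 1" b] n by (simp add: algebra_simps of_nat_diff)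
    from this[of "r * scaled_monomial z (int n - 1)"]
    have "?s (r * scaled_monomial z (int n) - r) \<in> B0"
      using z by (simp add: homology_class_eq_iff mult.assoc scaled_monomial_mult flip: single_diff)
    from twisted_boundaries_uminus[OF this] show "?s a \<in> B0"
      by (simp add: a algebra_simps flip: single_uminus)
  qed
qed

end

section \<open>A primitive root of unity and the final assembly\<close>

lemma primitive_root_of_unity_powi:
  assumes "n \<ge> 1"
  shows "cis (2 * pi / real n) powi k = 1 \<longleftrightarrow> int n dvd k"
proof
  assume "cis (2 * pi / real n) powi k = 1"
  then have "cos (of_int k * (2 * pi / real n)) = 1"
    by (simp add: cis_power_int complex_eq_iff)
  then obtain i :: int where "of_int k * (2 * pi / real n) = of_int i * 2 * pi"
    by (auto simp: cos_one_2pi_int)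
  then have "of_int k = of_int i * real n"
    using assms by (simp add: field_simps)
  then have "(of_int k :: real) = of_int (i * int n)" by simp
  then have "k = i * int n" by (simp only: of_int_eq_iff)
  then show "int n dvd k" by simp
next
  assume "int n dvd k"
  then obtain i where k: "k = int n * i" by (rule dvdE)
  have "of_int k * (2 * pi / real n) = 2 * pi * of_int i"
    using assms by (simp add: k)
  then show "cis (2 * pi / real n) powi k = 1"
    by (simp add: cis_power_int)
qed

theorem proposition5:
  fixes S N :: "'a::t2_space set"
    and K :: "real \<Rightarrow> 'a"
    and \<phi> :: "complex \<times> complex \<Rightarrow> 'a"
    and x0 :: 'a
    and \<mu> :: "(real \<Rightarrow> 'a) set"
    and \<epsilon> :: "(real \<Rightarrow> 'a) set \<Rightarrow> int"
    and n :: nat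
    and chi :: "(real \<Rightarrow> 'a) set set \<Rightarrow> complex"
    and z :: complex
    and \<pi> :: "(real \<Rightarrow> 'a) set monoid"
    and \<alpha> :: "(real \<Rightarrow> 'a) set \<Rightarrow> complex mat"
  assumes "integral_homology_3_sphere S"
    and "oriented_simple_closed_curve S K"
    and "tubular_parametrization S K \<phi>"
    and "N = knot_exterior S \<phi>"
    and "x0 \<in> N"
    and "\<pi> = fundamental_group N x0"
    and "is_meridian N \<phi> x0 \<mu>"
    and "is_abelianization_to_int \<pi> \<mu> \<epsilon>"
    and "n \<ge> 1"
    and "chi \<in> hom (alexander_group \<pi>) complex_units"
    and "factors_through_t_power_quotient \<pi> \<mu> n chi"
    and "z \<in> sphere 0 1"
    and "z ^ n = (-1) ^ (n + 1)"
    and "\<alpha> = metabelian_rep \<pi> \<mu> \<epsilon> n chi z"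
  shows "(\<forall>\<Delta>. is_twisted_alexander_polynomial N x0 \<epsilon> n \<alpha> 0 \<Delta> \<longleftrightarrow>
            equal_up_to_unit \<Delta>
              (if trivial_character \<pi> chi then 1 - Poly_Mapping.single (int n) ((-1) ^ (n + 1)) else 1)) \<and>
         (\<forall>\<Delta>. is_twisted_alexander_polynomial N x0 \<epsilon> n \<alpha> 1 \<Delta> \<longrightarrow>
            (\<exists>q. equal_up_to_unit \<Delta> (poly_in_t_power n q)))"
proof -
  note n = \<open>n \<ge> 1\<close>
  have z: "z \<noteq> 0" using assms(12) by auto
  have group: "group \<pi>"
    unfolding assms(6) by (rule group_fundamental_group[OF assms(5)])
  have \<mu>: "\<mu> \<in> carrier \<pi>"
    unfolding assms(6) using meridian_in_fundamental_group[OF assms(3)] assms(4,7) by simp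
  note facts = group \<mu> assms(8,10) n z
  have conn: "path_connected N"
    unfolding assms(4) using path_connected_knot_exterior[OF assms(3)] path_connected_integral_homology_3_sphere[OF assms(1)] .
  let ?\<rho> = "twisted_action \<alpha> \<epsilon>"
  have \<rho>: "?\<rho> g $$ (i, j) = Poly_Mapping.single (\<epsilon> g) (metabelian_rep \<pi> \<mu> \<epsilon> n chi z g $$ (i, j))" if "i < n" "j < n" for g i j
    using that metabelian_rep_dim[OF facts, of g] by (auto simp: twisted_action_def assms(14))
  have pow: "\<epsilon> (\<mu> [^]\<^bsub>\<pi>\<^esub> k) = k" for k :: int
    using group_hom.hom_int_pow[OF \<epsilon>_hom[OF facts(1-4)] \<mu>, of k] \<epsilon>_m[OF facts(1-4)] by simp
  have \<rho>_pow: "?\<rho> (\<mu> [^]\<^bsub>\<pi>\<^esub> k) $$ (i, j) = (if int n dvd int i - int j - k then scaled_monomial z k else 0)"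
    if "i < n" "j < n" for i j and k :: int
    unfolding \<rho>[OF that] metabelian_rep_index_power[OF facts that] pow by (simp add: scaled_monomial_def)
  have pow_carrier: "\<mu> [^]\<^bsub>\<pi>\<^esub> k \<in> carrier (fundamental_group N x0)" for k :: int
    using group.int_pow_closed[OF group \<mu>] by (simp add: assms(6))
  \<comment> \<open>The identity is written as the zeroth power of the meridian, so one entry
    formula serves for both distinguished elements.\<close>
  have \<rho>_e: "?\<rho> (\<mu> [^]\<^bsub>\<pi>\<^esub> (0::int)) $$ (i, j) = (if i = j then 1 else 0)" if "i < n" "j < n" for i j
    using \<rho>_pow[OF that, of 0] dvd_int_diff_iff_eq_mod[OF n that(1), of "int j"] that by simp
  have \<rho>_\<mu>: "?\<rho> (\<mu> [^]\<^bsub>\<pi>\<^esub> (1::int)) $$ (i, j) = (if i = Suc j mod n then scaled_monomial z 1 else 0)"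
    if "i < n" "j < n" for i j
  proof -
    have "nat (int (Suc j) mod int n) = Suc j mod n"
      by (simp only: of_nat_mod[symmetric] nat_int)
    then show ?thesis
      using \<rho>_pow[OF that, of 1] dvd_int_diff_iff_eq_mod[OF n that(1), of "int (Suc j)"]
      by (simp add: algebra_simps)
  qed
  note H0 = assms(5) conn n z pow_carrier[of 0] \<rho>_e pow_carrier[of 1] \<rho>_\<mu>
  show ?thesis
  proof (intro conjI allI impI)
    fix \<Delta>
    show "is_twisted_alexander_polynomial N x0 \<epsilon> n \<alpha> 0 \<Delta> \<longleftrightarrow> equal_up_to_unit \<Delta>
        (if trivial_character \<pi> chi then 1 - Poly_Mapping.single (int n) ((-1) ^ (n + 1)) else 1)"
    proof (cases "trivial_character \<pi> chi")
      case True
      have "is_order_of \<Delta> (twisted_homology N x0 n ?\<rho> 0) \<longleftrightarrow> equal_up_to_unit \<Delta> (1 - scaled_monomial z (int n))"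
      proof (rule twisted_order_0_trivial[OF H0])
        fix g i j assume g: "g \<in> carrier (fundamental_group N x0)" and ij: "i < n" "j < n"
        show "?\<rho> g $$ (i, j) = (if int n dvd int i - int j - \<epsilon> g then scaled_monomial z (\<epsilon> g) else 0)"
          unfolding \<rho>[OF ij] metabelian_rep_index_trivial[OF facts True g[folded assms(6)] ij]
          by (simp add: scaled_monomial_def)
      qed
      \<comment> \<open>The condition on z^n turns 1 - (z t)^n into the stated value, with the sign
        depending on the parity of n.\<close>
      then show ?thesis
        using True assms(13) by (simp add: is_twisted_alexander_polynomial_def scaled_monomial_def)
    next
      case False
      then obtain h where h: "h \<in> carrier (alexander_group \<pi>)" "chi h \<noteq> 1"
        unfolding trivial_character_def by blast
      then obtain g where g: "g \<in> commutator_subgroup \<pi>" "h = second_commutator_subgroup \<pi> #>\<^bsub>\<pi>\<^esub> g"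
        unfolding carrier_alexander_group[OF facts(1-4)] by blast
      have g': "g \<in> carrier \<pi>" "\<epsilon> g = 0"
        using g(1) commutator_iff[OF facts(1-4)] by auto
      have "is_order_of \<Delta> (twisted_homology N x0 n ?\<rho> 0) \<longleftrightarrow> equal_up_to_unit \<Delta> 1"
      proof (rule twisted_order_0_nontrivial[OF H0])
        show "g \<in> carrier (fundamental_group N x0)" using g' assms(6) by simp
        show "?\<rho> g $$ (i, 0) = (if i = 0 then Poly_Mapping.single 0 (chi h) else 0)" if "i < n" for i
        proof -
          have "0 < n" using n by simp
          from \<rho>[OF that this, of g] show ?thesis
            unfolding metabelian_rep_index_commutator[OF facts g(1) that] g' g(2) by simp
        qed
      qed (use h in auto)
      then show ?thesis
        using False by (simp add: is_twisted_alexander_polynomial_def)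
    qed
  next
    fix \<Delta> assume \<Delta>: "is_twisted_alexander_polynomial N x0 \<epsilon> n \<alpha> 1 \<Delta>"
    define w where "w = cis (2 * pi / real n)"
    have w: "w powi k = 1 \<longleftrightarrow> int n dvd k" for k
      unfolding w_def by (rule primitive_root_of_unity_powi[OF n])
    have w0: "w \<noteq> 0" by (simp add: w_def)
    show "\<exists>q. equal_up_to_unit \<Delta> (poly_in_t_power n q)"
    proof (rule order_twisted_homology_poly_in_t_power[OF n w])
      show "is_order_of \<Delta> (twisted_homology N x0 n ?\<rho> 1)"
        using \<Delta> by (simp add: is_twisted_alexander_polynomial_def)
      fix g i j assume ij: "i < n" "j < n"
      show "Poly_Mapping.single 0 (inverse w ^ i) * rescale w (?\<rho> g $$ (i, j)) =
          Poly_Mapping.single 0 (inverse w ^ j) * ?\<rho> g $$ (i, j)"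
      \<comment> \<open>On the support of the matrix \<epsilon>(g) is congruent to i - j, so
        w^\<epsilon>(g) = w^(i - j); off the support both sides are zero.\<close>
      proof (cases "int n dvd int i - int j - \<epsilon> g")
        case True
        then have "w powi (int i - int j - \<epsilon> g) = 1" using w by simp
        then have "inverse w ^ i * w powi \<epsilon> g = inverse w ^ j"
          using w0 by (simp add: power_int_diff power_int_add field_simps)
        then show ?thesis unfolding \<rho>[OF ij] by (simp add: mult_single flip: mult.assoc)
      next
        case False
        then show ?thesis
          unfolding \<rho>[OF ij] metabelian_rep_index[OF facts ij] by simp
      qed
    qed
  qed
qed

end
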